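(* Let $\mathbb{F}$ be an algebraic number field that is neither $\mathbb{Q}$ nor an imaginary quadratic extension of $\mathbb{Q}$, let $\mathcal{O}$ be the ring of integers of $\mathbb{F}$, and let $\Gamma$ be a finite-index subgroup of $\mathrm{SL}(2,\mathcal{O})$. Suppose that no proper subfield of $\mathbb{F}$ contains a finite-index subgroup of the group $\mathcal{O}^\times$ of units of $\mathcal{O}$, and let $U$ be any unipotent subgroup of $\Gamma$. Then, for every orientation-preserving action of $\Gamma$ on $\mathbb{R}$, the $U$-orbit of each point in $\mathbb{R}$ is a bounded set.
   Context: A subgroup $U$ of $\mathrm{SL}(\ell,\mathbb{C})$ is unipotent if it is conjugate to a subgroup of the group of upper-triangular matrices with all diagonal entries equal to $1$. An orientation-preserving action of a group $\Gamma$ on $\mathbb{R}$ is an action of $\Gamma$ by orientation-preserving homeomorphisms of the real line. *)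

theory Defs
  imports
    "HOL-Analysis.Analysis"
    "HOL-Algebra.Group_Action"
    "HOL-Algebra.Embedded_Algebras"
    "HOL-Algebra.Algebraic_Closure_Type"
    "Jordan_Normal_Form.Determinant"
begin

(* HOL-Analysis and Jordan_Normal_Form both define det; only matrices of type 'a mat occur here. *)
hide_const (open) Determinants.det

definition finite_index_subgroup :: "'a set \<Rightarrow> ('a, 'b) monoid_scheme \<Rightarrow> bool" where
  "finite_index_subgroup H G \<longleftrightarrow> subgroup H G \<and> finite (rcosets\<^bsub>G\<^esub> H)"

abbreviation complex_field :: "complex ring" where
  "complex_field \<equiv> ring_of_type_algebra"

(* Number fields are taken as subfields of the complex numbers; every abstract number field
   is isomorphic to one of these. *)
definition number_field :: "complex set \<Rightarrow> bool" where
  "number_field F \<longleftrightarrow> subfield F complex_field \<and> ring.finite_dimension complex_field \<rat> F"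

(* A quadratic subfield of the complex numbers is Galois over the rationals, so whether it is
   contained in the reals does not depend on the embedding. *)
definition imaginary_quadratic :: "complex set \<Rightarrow> bool" where
  "imaginary_quadratic F \<longleftrightarrow>
     subfield F complex_field \<and> ring.dimension complex_field 2 \<rat> F \<and> \<not> F \<subseteq> \<real>"

definition ring_of_integers :: "complex set \<Rightarrow> complex set" where
  "ring_of_integers F = {x \<in> F. algebraic_int x}"

definition integer_units :: "complex set \<Rightarrow> complex monoid" where
  "integer_units F = units_of (complex_field\<lparr>carrier := ring_of_integers F\<rparr>)"

definition SL :: "nat \<Rightarrow> 'a::comm_ring_1 set \<Rightarrow> 'a mat monoid" where
  "SL n R = \<lparr>carrier = {A \<in> carrier_mat n n. elements_mat A \<subseteq> R \<and> det A = 1},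
             mult = (*), one = 1\<^sub>m n\<rparr>"

definition upper_unitriangular_group :: "nat \<Rightarrow> complex mat monoid" where
  "upper_unitriangular_group n =
     (SL n UNIV)\<lparr>carrier := {A \<in> carrier_mat n n. upper_triangular A \<and> (\<forall>i<n. A $$ (i, i) = 1)}\<rparr>"

definition unipotent_subgroup :: "nat \<Rightarrow> complex mat set \<Rightarrow> bool" where
  "unipotent_subgroup n U \<longleftrightarrow> subgroup U (SL n UNIV) \<and>
     (\<exists>g \<in> carrier (SL n UNIV).
        subgroup ((\<lambda>u. g \<otimes>\<^bsub>SL n UNIV\<^esub> u \<otimes>\<^bsub>SL n UNIV\<^esub> inv\<^bsub>SL n UNIV\<^esub> g) ` U)
          (upper_unitriangular_group n))"

(* A homeomorphism of the line preserves orientation iff it is increasing. *)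
definition orientation_preserving_homeo :: "(real \<Rightarrow> real) \<Rightarrow> bool" where
  "orientation_preserving_homeo f \<longleftrightarrow> homeomorphic_map euclidean euclidean f \<and> strict_mono f"

definition orientation_preserving_action ::
    "('a, 'b) monoid_scheme \<Rightarrow> ('a \<Rightarrow> real \<Rightarrow> real) \<Rightarrow> bool" where
  "orientation_preserving_action G \<phi> \<longleftrightarrow>
     group_action G UNIV \<phi> \<and> (\<forall>g \<in> carrier G. orientation_preserving_homeo (\<phi> g))"

end

theory Submission
  imports Defs "Jordan_Normal_Form.Char_Poly"
begin

text \<open>
  A nontrivial unipotent \<open>U\<close> fixes a vector \<open>v\<close>, so it consists of transvections \<open>u\<^sub>v(s)\<close>, where
  \<open>s\<close> ranges over an additive group \<open>L\<close> that contains a \<open>\<rat>\<close>-basis of \<open>F\<close>. If the orbit of some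
  point is unbounded above, then finitely many commuting maps have no common fixed point near
  \<open>+\<infinity>\<close>; hence some \<open>u\<^sub>v(t)\<close> moves all points near \<open>+\<infinity>\<close> to the right. Choose \<open>C \<in> \<Gamma>\<close> that moves
  the line of \<open>v\<close>, and \<open>A \<in> \<Gamma>\<close> with \<open>A v = w v\<close> and \<open>A C v = w\<inverse> C v\<close> for a unit \<open>w \<noteq> \<plusminus>1\<close>. Conjugation
  by \<open>A\<close> multiplies \<open>s\<close> by \<open>w\<^sup>2\<close>. The elements of \<open>L\<close> with fixed points near \<open>+\<infinity>\<close> form a
  group stable under \<open>w\<^sup>2\<close>; as \<open>w\<^sup>2 - 1\<close> divides a nonzero integer, this group does not contain
  \<open>w\<^sup>2 t - t\<close>, so we may assume (inverting \<open>A\<close> if necessary) that \<open>w\<^sup>2 t - t\<close> also moves points to the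
  right. This forces every \<open>G \<in> \<Gamma>\<close> with \<open>G v = w v\<close> to move all large points to the right. Both \<open>A\<close>
  and \<open>C\<inverse> A\<inverse> C\<close> are such elements, so \<open>A\<close> and \<open>A\<inverse>\<close> both move all large points to the right,
  which is absurd. Boundedness below follows by reflecting the line.
\<close>

section \<open>Number fields and algebraic integers\<close>

text \<open>This makes the span and independence theory of \<open>vector_space\<close> available for
  the complex numbers over the rationals.\<close>

global_interpretation rat_vs: vector_space "\<lambda>(q::rat) (x::complex). of_rat q * x"
  by unfold_locales (auto simp: algebra_simps of_rat_add of_rat_mult)

interpretation complex_field: cring complex_field
  by (rule cring_from_type_algebra)

lemma complex_field_simps [simp]:
  "carrier complex_field = UNIV" "mult complex_field x y = x * y"
  "add complex_field x y = x + y" "\<zero>\<^bsub>complex_field\<^esub> = 0" "\<one>\<^bsub>complex_field\<^esub> = 1"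
  by (simp_all add: ring_of_type_algebra_def)

lemma complex_field_a_inv [simp]: "\<ominus>\<^bsub>complex_field\<^esub> x = - x"
  using complex_field.l_neg[of x] by (simp add: eq_neg_iff_add_eq_0)

lemma complex_field_m_inv: "x \<noteq> 0 \<Longrightarrow> inv\<^bsub>complex_field\<^esub> x = inverse x"
  by (rule complex_field.comm_inv_char) simp_all

lemma subfield_complexD:
  assumes "subfield F complex_field"
  shows "0 \<in> F" "1 \<in> F" "\<lbrakk>x \<in> F; y \<in> F\<rbrakk> \<Longrightarrow> x + y \<in> F" "\<lbrakk>x \<in> F; y \<in> F\<rbrakk> \<Longrightarrow> x * y \<in> F"
    "x \<in> F \<Longrightarrow> - x \<in> F" "\<lbrakk>x \<in> F; y \<in> F\<rbrakk> \<Longrightarrow> x - y \<in> F" "x \<in> F \<Longrightarrow> inverse x \<in> F"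
proof -
  note sr = subfieldE(1)[OF assms]
  note * = subringE[OF sr]
  show "0 \<in> F" "1 \<in> F" and add: "\<And>x y. \<lbrakk>x \<in> F; y \<in> F\<rbrakk> \<Longrightarrow> x + y \<in> F"
    and "\<lbrakk>x \<in> F; y \<in> F\<rbrakk> \<Longrightarrow> x * y \<in> F" and neg: "\<And>x. x \<in> F \<Longrightarrow> - x \<in> F"
    using * by auto
  show "\<lbrakk>x \<in> F; y \<in> F\<rbrakk> \<Longrightarrow> x - y \<in> F" using add neg by (metis diff_conv_add_uminus)
  show "x \<in> F \<Longrightarrow> inverse x \<in> F"
    using complex_field.subfield_m_inv(1)[OF assms, of x] complex_field_m_inv[of x] \<open>0 \<in> F\<close>
    by (cases "x = 0") auto
qed

lemma subfield_complex_Rats: "subfield \<rat> complex_field"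
proof (rule field.subfieldI'[OF field_from_type_algebra])
  show "subring \<rat> complex_field" by (rule complex_field.subringI) auto
  show "inv\<^bsub>complex_field\<^esub> k \<in> \<rat>" if "k \<in> \<rat> - {\<zero>\<^bsub>complex_field\<^esub>}" for k
    using that by (simp add: complex_field_m_inv)
qed

lemma Rats_subset_subfield:
  assumes "subfield F complex_field" shows "\<rat> \<subseteq> F"
proof
  fix x :: complex assume "x \<in> \<rat>"
  note D = subfield_complexD[OF assms]
  have nat: "of_nat n \<in> F" for n by (induction n) (auto intro: D)
  have int: "of_int n \<in> F" for n
    by (cases n rule: int_cases2) (auto simp: nat intro: D)
  from \<open>x \<in> \<rat>\<close> obtain a b where "x = of_int a / of_int b" by (elim Rats_cases') auto
  then show "x \<in> F" using D(4)[OF int D(7)[OF int]] by (simp add: divide_inverse)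
qed

text \<open>Translates \<open>finite_dimension\<close> into \<open>rat_vs\<close>. From here on
  finiteness of \<open>F\<close> enters only through a finite spanning set.\<close>

lemma number_field_span:
  assumes "number_field F"
  obtains B where "finite B" "B \<subseteq> F" "F \<subseteq> rat_vs.span B"
proof -
  from assms have F: "subfield F complex_field" and fd: "ring.finite_dimension complex_field \<rat> F"
    by (auto simp: number_field_def)
  obtain n where "ring.dimension complex_field n \<rat> F"
    using fd complex_field.finite_dimension_def by blast
  then obtain Vs where Vs: "complex_field.Span \<rat> Vs = F"
    using complex_field.exists_base[OF subfield_complex_Rats] by blast
  have span: "complex_field.Span \<rat> Us \<subseteq> rat_vs.span (set Us)" for Us
  proof (induction Us)
    case (Cons u Us)
    show ?case
    proof
      fix x assume "x \<in> complex_field.Span \<rat> (u # Us)"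
      then obtain k v where kv: "k \<in> \<rat>" "v \<in> complex_field.Span \<rat> Us" "x = k * u + v"
        by (auto simp: complex_field.line_extension_mem_iff)
      from kv(1) obtain q where q: "k = of_rat q" by (elim Rats_cases)
      have "v \<in> rat_vs.span (set (u # Us))" using kv(2) Cons rat_vs.span_mono[of "set Us" "set (u # Us)"] by auto
      moreover have "of_rat q * u \<in> rat_vs.span (set (u # Us))"
        by (intro rat_vs.span_scale rat_vs.span_base) simp
      ultimately show "x \<in> rat_vs.span (set (u # Us))" using kv(3) q rat_vs.span_add by blast
    qed
  qed simp
  have "set Vs \<subseteq> F"
    using complex_field.Span_base_incl[OF subfield_complex_Rats, of Vs] Vs by auto
  with that span[of Vs] Vs show ?thesis by blast
qed

lemma rat_common_denominator:
  fixes u :: "'b \<Rightarrow> rat"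
  assumes B: "finite B"
  obtains n :: int and c :: "'b \<Rightarrow> int" where "n > 0" "\<And>b. b \<in> B \<Longrightarrow> of_int n * u b = of_int (c b)"
proof -
  define den where "den b = snd (quotient_of (u b))" for b
  define n where "n = (\<Prod>b\<in>B. den b)"
  define c where "c b = fst (quotient_of (u b)) * (n div den b)" for b
  have den: "den b > 0" for b unfolding den_def by (rule quotient_of_denom_pos')
  have n: "n > 0" unfolding n_def using den by (simp add: prod_pos)
  have "of_int n * u b = of_int (c b)" if "b \<in> B" for b
  proof -
    have u: "u b = of_int (fst (quotient_of (u b))) / of_int (den b)"
      unfolding den_def by (rule quotient_of_div) simp
    have "n = den b * (n div den b)"
      using dvd_prodI[OF B that, of den] by (simp add: n_def)
    then have "(of_int n :: rat) = of_int (den b) * of_int (n div den b)" by (metis of_int_mult)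
    then show ?thesis using den[of b] by (subst u) (simp add: c_def)
  qed
  with n that show ?thesis by blast
qed

lemma span_common_denominator:
  assumes B: "finite B" and x: "x \<in> rat_vs.span B"
  obtains n :: int and c :: "complex \<Rightarrow> int" where "n > 0" "of_int n * x = (\<Sum>b\<in>B. of_int (c b) * b)"
proof -
  obtain u where u: "x = (\<Sum>b\<in>B. of_rat (u b) * b)"
    using x rat_vs.span_finite[OF B] by auto
  obtain n c where n: "n > 0" and c: "\<And>b. b \<in> B \<Longrightarrow> of_int n * u b = of_int (c b)"
    using rat_common_denominator[OF B] by blast
  have "of_int n * (of_rat (u b) * b) = of_int (c b) * b" if "b \<in> B" for b
    using arg_cong[OF c[OF that], of "of_rat :: rat \<Rightarrow> complex"] by (simp add: of_rat_mult)
  then have "of_int n * x = (\<Sum>b\<in>B. of_int (c b) * b)"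
    unfolding u sum_distrib_left by (rule sum.cong[OF refl])
  with n that show ?thesis by blast
qed

section \<open>Sums and products of algebraic integers\<close>

text \<open>The characteristic polynomial of an integer matrix is monic with integer coefficients
  and vanishes at the eigenvalues.\<close>

lemma algebraic_int_if_eigenvalue:
  assumes A: "A \<in> carrier_mat n n" and ev: "eigenvalue (map_mat of_int A :: complex mat) x"
  shows "algebraic_int x"
proof -
  let ?A = "map_mat of_int A :: complex mat"
  have cA: "?A \<in> carrier_mat n n" using A by simp
  have "poly (char_poly ?A) x = 0" using eigenvalue_root_char_poly[OF cA] ev by simp
  moreover have "char_poly ?A = map_poly of_int (char_poly A)" by (rule of_int_hom.char_poly_hom[OF A])
  moreover have "monic (char_poly A)" using degree_monic_char_poly[OF A] by simp
  ultimately show ?thesis unfolding algebraic_int_altdef_ipoly by auto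
qed

text \<open>The additive group generated by \<open>V\<close>, provided that \<open>V\<close> is
  finite; for infinite \<open>V\<close> every such sum is 0 by convention.\<close>

definition int_span :: "complex set \<Rightarrow> complex set" where
  "int_span V = {\<Sum>v\<in>V. of_int (c v) * v | c :: complex \<Rightarrow> int. True}"

lemma int_span_sum:
  assumes "finite I" "\<And>i. i \<in> I \<Longrightarrow> f i \<in> int_span V"
  shows "(\<Sum>i\<in>I. of_int (k i) * f i) \<in> int_span V"
proof -
  from assms(2) have "\<forall>i\<in>I. \<exists>c. f i = (\<Sum>v\<in>V. of_int (c v) * v)" by (auto simp: int_span_def)
  then obtain c where "\<forall>i\<in>I. f i = (\<Sum>v\<in>V. of_int (c i v) * v)" by metis
  then have "(\<Sum>i\<in>I. of_int (k i) * f i) = (\<Sum>i\<in>I. \<Sum>v\<in>V. of_int (k i * c i v) * v)"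
    by (intro sum.cong refl) (auto simp: sum_distrib_left mult.assoc)
  also have "\<dots> = (\<Sum>v\<in>V. of_int (\<Sum>i\<in>I. k i * c i v) * v)"
    by (subst sum.swap) (simp add: sum_distrib_right)
  finally show ?thesis unfolding int_span_def by (auto intro: exI[of _ "\<lambda>v. \<Sum>i\<in>I. k i * c i v"])
qed

lemma int_span_base: "\<lbrakk>finite V; v \<in> V\<rbrakk> \<Longrightarrow> v \<in> int_span V"
  unfolding int_span_def
  by (auto intro!: exI[of _ "\<lambda>w. if w = v then 1 else 0"]
      simp: if_distrib[of of_int] if_distrib[of "\<lambda>c. c * _"] sum.delta' cong: if_cong)

text \<open>Indexing by the two booleans instead of by \<open>{x, y}\<close> keeps the summands
  apart when \<open>x = y\<close>.\<close>

lemma int_span_add: "\<lbrakk>x \<in> int_span V; y \<in> int_span V\<rbrakk> \<Longrightarrow> x + y \<in> int_span V"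
  using int_span_sum[of "{True, False}" "\<lambda>b. if b then x else y" V "\<lambda>_. 1"] by simp

text \<open>The determinant trick: \<open>x\<close> is an eigenvalue of the integer matrix that expresses
  multiplication by \<open>x\<close> on generators of the lattice.\<close>
lemma algebraic_int_if_stable:
  assumes V: "finite V" "v \<in> V" "v \<noteq> 0" and stable: "\<And>w. w \<in> V \<Longrightarrow> x * w \<in> int_span V"
  shows "algebraic_int x"
proof -
  obtain vs where vs: "set vs = V" "distinct vs" using V(1) finite_distinct_list by blast
  define n where "n = length vs"
  from stable have "\<forall>w\<in>V. \<exists>c. x * w = (\<Sum>v\<in>V. of_int (c v) * v)" by (auto simp: int_span_def)
  then obtain c :: "complex \<Rightarrow> complex \<Rightarrow> int" where c: "\<forall>w\<in>V. x * w = (\<Sum>v\<in>V. of_int (c w v) * v)" by metis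
  define A where "A = Matrix.mat n n (\<lambda>(i, j). c (vs ! i) (vs ! j))"
  define u where "u = Matrix.vec n (\<lambda>i. vs ! i)"
  have A: "A \<in> carrier_mat n n" by (simp add: A_def)
  have "map_mat of_int A *\<^sub>v u = x \<cdot>\<^sub>v u"
  proof (rule eq_vecI)
    fix i assume "i < dim_vec (x \<cdot>\<^sub>v u)"
    then have i: "i < n" by (simp add: u_def)
    then have "x * vs ! i = (\<Sum>v\<in>set vs. of_int (c (vs ! i) v) * v)" using c vs(1) n_def by auto
    also have "\<dots> = (\<Sum>j<n. of_int (c (vs ! i) (vs ! j)) * vs ! j)"
      by (rule sum.reindex_bij_betw[symmetric]) (use bij_betw_nth[OF vs(2)] n_def in auto)
    also have "\<dots> = (map_mat of_int A *\<^sub>v u) $ i"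
      using i by (simp add: A_def u_def scalar_prod_def lessThan_atLeast0)
    finally show "(map_mat of_int A *\<^sub>v u) $ i = (x \<cdot>\<^sub>v u) $ i" using i by (simp add: u_def)
  qed (simp_all add: A_def u_def)
  moreover have "u \<noteq> 0\<^sub>v n"
  proof
    assume u0: "u = 0\<^sub>v n"
    obtain i where "i < n" "vs ! i = v" using V(2) vs(1) by (auto simp: in_set_conv_nth n_def)
    then show False using V(3) arg_cong[OF u0, of "\<lambda>w. vec_index w i"] by (simp add: u_def)
  qed
  ultimately have "eigenvalue (map_mat of_int A) x"
    unfolding eigenvalue_def eigenvector_def by (intro exI[of _ u]) (simp add: u_def A_def)
  then show ?thesis by (rule algebraic_int_if_eigenvalue[OF A])
qed

lemma int_span_mult_left:
  assumes "finite V" "\<And>w. w \<in> V \<Longrightarrow> x * w \<in> int_span V" "y \<in> int_span V"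
  shows "x * y \<in> int_span V"
proof -
  from assms(3) obtain c where y: "y = (\<Sum>v\<in>V. of_int (c v) * v)" by (auto simp: int_span_def)
  have "x * y = (\<Sum>v\<in>V. of_int (c v) * (x * v))" by (simp add: y sum_distrib_left mult.left_commute)
  then show ?thesis using int_span_sum[of V "\<lambda>v. x * v" V c] assms by simp
qed

text \<open>\<open>V\<close> consists of the monomials \<open>x ^ i * y ^ j\<close> with exponents
  below the degrees of monic equations of \<open>x\<close> and \<open>y\<close>. A factor that
  raises an exponent to the degree is rewritten by the equation. One lattice thus serves both the
  sum and the product.\<close>

lemma algebraic_int_monomials:
  assumes "algebraic_int x" "algebraic_int y"
  obtains V where "finite V" "1 \<in> V" "\<And>w. w \<in> V \<Longrightarrow> x * w \<in> int_span V"
    "\<And>w. w \<in> V \<Longrightarrow> y * w \<in> int_span V"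
proof -
  have red: "\<exists>m>0. \<exists>c :: nat \<Rightarrow> int. z ^ m = (\<Sum>i<m. of_int (c i) * z ^ i)"
    if z: "algebraic_int z" for z :: complex
  proof -
    from z obtain p :: "int poly" where p: "poly (map_poly of_int p) z = 0" "Polynomial.coeff p (Polynomial.degree p) = 1"
      by (auto simp: algebraic_int_altdef_ipoly)
    \<comment> \<open>Positive degrees ensure that the monomial 1 belongs to
      \<open>V\<close>.\<close>
    have "Polynomial.degree p > 0"
    proof (rule ccontr)
      assume "\<not> Polynomial.degree p > 0"
      then have "p = [:1:]" using p(2) by (auto elim: degree_eq_zeroE)
      then show False using p(1) by simp
    qed
    have "0 = (\<Sum>i\<le>Polynomial.degree p. of_int (Polynomial.coeff p i) * z ^ i)"
      using p(1) by (simp add: poly_altdef)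
    also have "\<dots> = (\<Sum>i<Polynomial.degree p. of_int (Polynomial.coeff p i) * z ^ i) + z ^ Polynomial.degree p"
      using p(2) by (simp add: lessThan_Suc_atMost[symmetric])
    finally have "z ^ Polynomial.degree p = (\<Sum>i<Polynomial.degree p. of_int (- Polynomial.coeff p i) * z ^ i)"
      by (simp add: sum_negf eq_neg_iff_add_eq_0 add.commute)
    with \<open>Polynomial.degree p > 0\<close> show ?thesis by (intro exI[of _ "Polynomial.degree p"] conjI exI[of _ "\<lambda>i. - Polynomial.coeff p i"])
  qed
  obtain m c where m: "m > 0" "x ^ m = (\<Sum>i<m. of_int (c i) * x ^ i)" for i using red[OF assms(1)] by blast
  obtain n d where n: "n > 0" "y ^ n = (\<Sum>i<n. of_int (d i) * y ^ i)" for i using red[OF assms(2)] by blast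
  define V where "V = (\<lambda>(i, j). x ^ i * y ^ j) ` ({..<m} \<times> {..<n})"
  have fin: "finite V" by (simp add: V_def)
  have mem: "x ^ i * y ^ j \<in> int_span V" if "i < m" "j < n" for i j
    using that by (intro int_span_base[OF fin]) (auto simp: V_def)
  have "x * w \<in> int_span V \<and> y * w \<in> int_span V" if "w \<in> V" for w
  proof -
    from that obtain i j where ij: "i < m" "j < n" "w = x ^ i * y ^ j" by (auto simp: V_def)
    have "x * w \<in> int_span V"
    proof (cases "Suc i < m")
      case True
      then show ?thesis using mem[of "Suc i" j] ij by (simp add: mult_ac)
    next
      case False
      then have "Suc i = m" using ij by simp
      then have "x * w = x ^ m * y ^ j" using ij by (auto simp: mult_ac)
      also have "\<dots> = (\<Sum>k<m. of_int (c k) * (x ^ k * y ^ j))"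
        by (simp add: m(2) sum_distrib_right mult.assoc)
      finally show ?thesis using int_span_sum[of "{..<m}" "\<lambda>k. x ^ k * y ^ j" V c] mem ij by simp
    qed
    moreover have "y * w \<in> int_span V"
    proof (cases "Suc j < n")
      case True
      then show ?thesis using mem[of i "Suc j"] ij by (simp add: mult_ac)
    next
      case False
      then have "Suc j = n" using ij by simp
      then have "y * w = x ^ i * y ^ n" using ij by (auto simp: mult_ac)
      also have "\<dots> = (\<Sum>k<n. of_int (d k) * (x ^ i * y ^ k))"
        by (simp add: n(2) sum_distrib_left mult_ac)
      finally show ?thesis using int_span_sum[of "{..<n}" "\<lambda>k. x ^ i * y ^ k" V d] mem ij by simp
    qed
    ultimately show ?thesis by blast
  qed
  moreover have "1 \<in> V" using m(1) n(1) by (auto simp: V_def intro!: image_eqI[of _ _ "(0, 0)"])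
  ultimately show ?thesis using that fin by blast
qed

lemma algebraic_int_add:
  assumes "algebraic_int x" "algebraic_int (y :: complex)" shows "algebraic_int (x + y)"
proof -
  from algebraic_int_monomials[OF assms] obtain V where V: "finite V" "1 \<in> V"
    "\<And>w. w \<in> V \<Longrightarrow> x * w \<in> int_span V" "\<And>w. w \<in> V \<Longrightarrow> y * w \<in> int_span V" by blast
  show ?thesis
    by (rule algebraic_int_if_stable[OF V(1,2)]) (simp_all add: distrib_right int_span_add V)
qed

lemma algebraic_int_mult:
  assumes "algebraic_int x" "algebraic_int (y :: complex)" shows "algebraic_int (x * y)"
proof -
  from algebraic_int_monomials[OF assms] obtain V where V: "finite V" "1 \<in> V"
    "\<And>w. w \<in> V \<Longrightarrow> x * w \<in> int_span V" "\<And>w. w \<in> V \<Longrightarrow> y * w \<in> int_span V" by blast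
  show ?thesis
    by (rule algebraic_int_if_stable[OF V(1,2)]) (simp_all add: mult.assoc int_span_mult_left[OF V(1,3)] V)
qed

section \<open>Finite quotients of additive groups of finite rank\<close>

text \<open>Infinite descent: an integer relation could be divided by \<open>p\<close> forever.\<close>
lemma prime_independent_card_le:
  fixes p :: int
  assumes p: "Factorial_Ring.prime p" and B: "finite B" and S: "finite S" "S \<subseteq> rat_vs.span B"
    and indep: "\<And>c. (\<Sum>s\<in>S. of_int (c s) * s) = 0 \<Longrightarrow> \<forall>s\<in>S. p dvd c s"
  shows "card S \<le> card B"
proof (rule ccontr)
  assume "\<not> ?thesis"
  then have "rat_vs.dependent S" using rat_vs.independent_span_bound[OF B _ S(2)] by blast
  then obtain u v where u: "(\<Sum>s\<in>S. of_rat (u s) * s) = 0" and v: "v \<in> S" "u v \<noteq> 0"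
    using rat_vs.dependent_finite[OF S(1)] by auto
  obtain n c where n: "n > 0" and c: "\<And>b. b \<in> S \<Longrightarrow> of_int n * u b = of_int (c b)"
    using rat_common_denominator[OF S(1)] by blast
  have "of_int (c s) * s = of_int n * (of_rat (u s) * s)" if "s \<in> S" for s
    using arg_cong[OF c[OF that], of "of_rat :: rat \<Rightarrow> complex"] by (simp add: of_rat_mult)
  then have "(\<Sum>s\<in>S. of_int (c s) * s) = of_int n * (\<Sum>s\<in>S. of_rat (u s) * s)"
    unfolding sum_distrib_left by (rule sum.cong[OF refl])
  then have c0: "(\<Sum>s\<in>S. of_int (c s) * s) = 0" using u by simp
  have "\<forall>s\<in>S. p ^ k dvd c s" for k
  proof (induction k)
    case (Suc k)
    define d where "d s = c s div p ^ k" for s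
    have d: "c s = p ^ k * d s" if "s \<in> S" for s using Suc that by (simp add: d_def)
    have "(\<Sum>s\<in>S. of_int (c s) * s) = of_int (p ^ k) * (\<Sum>s\<in>S. of_int (d s) * s)"
      unfolding sum_distrib_left by (rule sum.cong[OF refl]) (simp add: d)
    moreover have "p \<noteq> 0" using p by auto
    ultimately have "(\<Sum>s\<in>S. of_int (d s) * s) = 0" using c0 by simp
    then have "\<forall>s\<in>S. p dvd d s" by (rule indep)
    then show ?case using d by (metis mult.commute mult_dvd_mono dvd_refl power_Suc)
  qed simp
  then have dvd: "p ^ k dvd c v" for k using v(1) by blast
  have cv: "c v \<noteq> 0" using c[OF v(1)] n v(2) by auto
  have "p \<ge> 2" using p by (rule prime_ge_2_int)
  have "int k < p ^ k" for k
  proof -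
    have "int k < 2 ^ k" by (rule of_nat_less_two_power)
    also have "\<dots> \<le> p ^ k" using \<open>p \<ge> 2\<close> by (intro power_mono) auto
    finally show ?thesis .
  qed
  from this[of "nat \<bar>c v\<bar>"] dvd_imp_le_int[OF cv dvd[of "nat \<bar>c v\<bar>"]] show False
    using \<open>p \<ge> 2\<close> by (simp add: abs_of_pos)
qed

text \<open>To be applied to the ring of integers. Lying in a finite-dimensional space is enough for
  finite quotients modulo integers, so no integral basis has to be constructed.\<close>

locale finite_rank_subgroup =
  fixes R B :: "complex set"
  assumes zero: "0 \<in> R" and add: "\<lbrakk>x \<in> R; y \<in> R\<rbrakk> \<Longrightarrow> x + y \<in> R" and uminus: "x \<in> R \<Longrightarrow> - x \<in> R"
    and fin: "finite B" and span: "R \<subseteq> rat_vs.span B"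
begin

lemma of_int_mult: "x \<in> R \<Longrightarrow> of_int n * x \<in> R"
proof -
  assume x: "x \<in> R"
  have "of_nat k * x \<in> R" for k by (induction k) (auto simp: zero add x distrib_right)
  then show ?thesis by (cases n rule: int_cases2) (auto intro: uminus)
qed

lemma sum_of_int: "\<lbrakk>finite S; S \<subseteq> R\<rbrakk> \<Longrightarrow> (\<Sum>s\<in>S. of_int (c s) * s) \<in> R"
  by (induction S rule: finite_induct) (auto simp: zero add of_int_mult)

text \<open>\<open>R / pR\<close> is a vector space over the field with \<open>p\<close> elements.
  Its independent systems have at most \<open>card B\<close> members, and the combinations of a
  maximal one with coefficients in \<open>{0..<p}\<close> represent all classes.\<close>

lemma finite_quotient_prime:
  fixes p :: int
  assumes p: "Factorial_Ring.prime p"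
  shows "\<exists>T. finite T \<and> (\<forall>x\<in>R. \<exists>t\<in>T. \<exists>y\<in>R. x = t + of_int p * y)"
proof -
  \<comment> \<open>Linear independence modulo \<open>p\<close> of the images in
    \<open>R / pR\<close>.\<close>
  define indep where "indep S \<longleftrightarrow> finite S \<and> S \<subseteq> R \<and>
    (\<forall>c. (\<exists>y\<in>R. (\<Sum>s\<in>S. of_int (c s) * s) = of_int p * y) \<longrightarrow> (\<forall>s\<in>S. p dvd c s))" for S
  have "card S < Suc (card B)" if S: "indep S" for S
  proof -
    have "card S \<le> card B"
    proof (rule prime_independent_card_le[OF p fin])
      show "\<forall>s\<in>S. p dvd c s" if "(\<Sum>s\<in>S. of_int (c s) * s) = 0" for c
      proof -
        have "\<exists>y\<in>R. (\<Sum>s\<in>S. of_int (c s) * s) = of_int p * y"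
          using that zero by (intro bexI[of _ 0]) simp
        then show ?thesis using S unfolding indep_def by blast
      qed
    qed (use S span in \<open>auto simp: indep_def\<close>)
    then show ?thesis by simp
  qed
  moreover have "indep {}" by (simp add: indep_def)
  ultimately obtain S where S: "indep S" and max: "\<And>S'. indep S' \<Longrightarrow> card S' \<le> card S"
    using ex_has_greatest_nat[of indep "{}" card "Suc (card B)"] by blast
  have SR: "finite S" "S \<subseteq> R" using S by (auto simp: indep_def)
  \<comment> \<open>Extensional coefficient functions, because only finitely many of them map
    \<open>S\<close> to \<open>{0..<p}\<close>.\<close>
  define T where "T = (\<lambda>c. \<Sum>s\<in>S. of_int (c s) * s) ` (S \<rightarrow>\<^sub>E {0..<p})"
  have "finite T" unfolding T_def using SR by (intro finite_imageI finite_PiE) auto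
  moreover have "\<exists>t\<in>T. \<exists>y\<in>R. x = t + of_int p * y" if x: "x \<in> R" for x
  proof -
    have "\<exists>d y. y \<in> R \<and> x = (\<Sum>s\<in>S. of_int (d s) * s) + of_int p * y"
    proof (cases "x \<in> S")
      case True
      have "(\<Sum>s\<in>S. of_int (if s = x then 1 else 0) * s) = (\<Sum>s\<in>S. if s = x then s else 0)"
        by (rule sum.cong) auto
      also have "\<dots> = x" using True SR by simp
      finally show ?thesis using zero
        by (intro exI[of _ "\<lambda>s. if s = x then 1 else 0"] exI[of _ 0]) simp
    next
      case False
      \<comment> \<open>Maximality of \<open>S\<close> yields a relation modulo \<open>pR\<close>
        that involves \<open>x\<close>; its coefficient at \<open>x\<close> is invertible modulo
        \<open>p\<close>, so the relation can be solved for \<open>x\<close>.\<close>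
      then have "\<not> indep (insert x S)" using max[of "insert x S"] SR by auto
      then obtain c y s where y: "y \<in> R" "(\<Sum>s\<in>insert x S. of_int (c s) * s) = of_int p * y"
        and s: "s \<in> insert x S" "\<not> p dvd c s"
        using SR x unfolding indep_def by blast
      have eq: "of_int (c x) * x + (\<Sum>s\<in>S. of_int (c s) * s) = of_int p * y"
        using y(2) False SR by simp
      have "\<not> p dvd c x"
      proof
        assume "p dvd c x"
        then obtain k where k: "c x = p * k" by blast
        have "(\<Sum>s\<in>S. of_int (c s) * s) = of_int p * (y + of_int (- k) * x)"
          using eq by (simp add: k algebra_simps)
        moreover have "y + of_int (- k) * x \<in> R" using y x by (intro add of_int_mult)
        ultimately have "\<forall>s\<in>S. p dvd c s" using S unfolding indep_def by blast
        with s \<open>p dvd c x\<close> show False by blast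
      qed
      then have "coprime p (c x)" using p by (simp add: prime_imp_coprime)
      then obtain e f where ef: "e * c x + f * p = 1"
        by (metis bezout_int coprime_iff_gcd_eq_1 gcd.commute)
      define z where "z = of_int e * y + of_int f * x"
      have "z \<in> R" unfolding z_def using x y by (intro add of_int_mult)
      moreover have "x = (\<Sum>s\<in>S. of_int (- e * c s) * s) + of_int p * z"
      proof -
        have "x = of_int (e * c x + f * p) * x" by (simp add: ef)
        also have "\<dots> = of_int e * (of_int (c x) * x) + of_int p * (of_int f * x)"
          by (simp add: algebra_simps)
        also have "of_int (c x) * x = of_int p * y - (\<Sum>s\<in>S. of_int (c s) * s)"
          using eq by (simp add: algebra_simps)
        also have "of_int e * (of_int p * y - (\<Sum>s\<in>S. of_int (c s) * s)) + of_int p * (of_int f * x)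
            = - (of_int e * (\<Sum>s\<in>S. of_int (c s) * s)) + of_int p * z"
          by (simp add: z_def algebra_simps)
        also have "- (of_int e * (\<Sum>s\<in>S. of_int (c s) * s)) = (\<Sum>s\<in>S. of_int (- e * c s) * s)"
          by (simp add: sum_distrib_left sum_negf[symmetric] mult.assoc)
        finally show ?thesis .
      qed
      ultimately show ?thesis by (intro exI[of _ "\<lambda>s. - e * c s"] exI[of _ z] conjI)
    qed
    then obtain d y where y: "y \<in> R" and d: "x = (\<Sum>s\<in>S. of_int (d s) * s) + of_int p * y" by blast
    have pp: "p > 0" using p by (simp add: prime_gt_0_int)
    \<comment> \<open>Reduce the coefficients modulo \<open>p\<close> and move the multiples of
      \<open>p\<close> into the \<open>pR\<close> part. The restriction to \<open>S\<close> makes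
      the coefficient function extensional, as \<open>T\<close> demands.\<close>
    have "(\<Sum>s\<in>S. of_int (d s) * s) =
        (\<Sum>s\<in>S. of_int (d s mod p) * s + of_int p * (of_int (d s div p) * s))"
    proof (rule sum.cong[OF refl])
      fix s
      have "(of_int (d s) :: complex) = of_int (p * (d s div p) + d s mod p)" by simp
      then show "of_int (d s) * s = of_int (d s mod p) * s + of_int p * (of_int (d s div p) * s)"
        by (simp only: of_int_add of_int_mult) (simp add: algebra_simps)
    qed
    also have "\<dots> = (\<Sum>s\<in>S. of_int (restrict (\<lambda>s. d s mod p) S s) * s)
        + of_int p * (\<Sum>s\<in>S. of_int (d s div p) * s)"
      by (simp add: sum.distrib sum_distrib_left)
    finally have eq: "x = (\<Sum>s\<in>S. of_int (restrict (\<lambda>s. d s mod p) S s) * s)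
        + of_int p * ((\<Sum>s\<in>S. of_int (d s div p) * s) + y)"
      by (simp add: d distrib_left)
    have tT: "(\<Sum>s\<in>S. of_int (restrict (\<lambda>s. d s mod p) S s) * s) \<in> T"
      unfolding T_def using pp by (intro imageI) auto
    have yR: "(\<Sum>s\<in>S. of_int (d s div p) * s) + y \<in> R" using SR y by (intro add sum_of_int)
    show ?thesis by (rule bexI[OF _ tT], rule bexI[OF _ yR], rule eq)
  qed
  ultimately show ?thesis by blast
qed

text \<open>Induction over the prime factors: representatives \<open>t\<close> modulo
  \<open>p\<close> and \<open>s\<close> modulo \<open>n\<close> combine to the representatives
  \<open>t + p s\<close> modulo \<open>p n\<close>.\<close>

lemma finite_quotient:
  "n > 0 \<Longrightarrow> \<exists>T. finite T \<and> (\<forall>x\<in>R. \<exists>t\<in>T. \<exists>y\<in>R. x = t + of_nat n * y)"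
proof (induction n rule: prime_divisors_induct)
  case (unit n)
  then show ?case by (intro exI[of _ "{0}"]) auto
next
  case (factor p n)
  have "n > 0" using factor.prems by simp
  then obtain T where T: "finite T" "\<And>x. x \<in> R \<Longrightarrow> \<exists>t\<in>T. \<exists>y\<in>R. x = t + of_nat n * y"
    using factor.IH by blast
  have "Factorial_Ring.prime (int p)" using factor.hyps by simp
  from finite_quotient_prime[OF this]
  obtain T' where T': "finite T'" "\<And>x. x \<in> R \<Longrightarrow> \<exists>t\<in>T'. \<exists>y\<in>R. x = t + of_nat p * y"
    unfolding of_int_of_nat_eq by blast
  have "\<exists>t\<in>(\<lambda>(s, t). s + of_nat p * t) ` (T' \<times> T). \<exists>y\<in>R. x = t + of_nat (p * n) * y"
    if x: "x \<in> R" for x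
  proof -
    obtain t y where ty: "t \<in> T'" "y \<in> R" "x = t + of_nat p * y" using T'(2)[OF x] by blast
    obtain s z where sz: "s \<in> T" "z \<in> R" "y = s + of_nat n * z" using T(2)[OF ty(2)] by blast
    have "x = (t + of_nat p * s) + of_nat (p * n) * z" using ty sz by (simp add: algebra_simps)
    moreover have "t + of_nat p * s \<in> (\<lambda>(s, t). s + of_nat p * t) ` (T' \<times> T)"
      using ty sz by (intro image_eqI[of _ _ "(t, s)"]) auto
    ultimately show ?thesis using sz by blast
  qed
  then show ?case using T T' by (intro exI[of _ "(\<lambda>(s, t). s + of_nat p * t) ` (T' \<times> T)"]) simp
qed simp

text \<open>Pigeonhole over the finitely many classes modulo \<open>n\<close>.\<close>

lemma infinite_congruent_subset:
  fixes n :: int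
  assumes n: "n \<noteq> 0" and S: "infinite S" "S \<subseteq> R"
  obtains S' where "infinite S'" "S' \<subseteq> S" "\<And>s t. \<lbrakk>s \<in> S'; t \<in> S'\<rbrakk> \<Longrightarrow> \<exists>y\<in>R. s - t = of_int n * y"
proof -
  obtain T where T: "finite T" "\<And>x. x \<in> R \<Longrightarrow> \<exists>t\<in>T. \<exists>y\<in>R. x = t + of_nat (nat \<bar>n\<bar>) * y"
    using finite_quotient[of "nat \<bar>n\<bar>"] n by auto
  then obtain f where f: "\<And>x. x \<in> R \<Longrightarrow> f x \<in> T \<and> (\<exists>y\<in>R. x = f x + of_nat (nat \<bar>n\<bar>) * y)" by metis
  have "finite (f ` S)" using finite_subset[OF _ T(1)] f S(2) by blast
  then obtain a where a: "infinite {s \<in> S. f s = f a}" using pigeonhole_infinite[OF S(1)] by blast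
  have "\<exists>y\<in>R. s - t = of_int n * y" if "s \<in> {s \<in> S. f s = f a}" "t \<in> {s \<in> S. f s = f a}" for s t
  proof -
    from that have "s \<in> R" "t \<in> R" "f s = f t" using S(2) by auto
    then obtain y z where yz: "y \<in> R" "z \<in> R" "s = f t + of_nat (nat \<bar>n\<bar>) * y" "t = f t + of_nat (nat \<bar>n\<bar>) * z"
      using f by metis
    have "s - t = (f t + of_nat (nat \<bar>n\<bar>) * y) - (f t + of_nat (nat \<bar>n\<bar>) * z)"
      by (rule arg_cong2[OF yz(3,4)])
    also have "\<dots> = of_nat (nat \<bar>n\<bar>) * (y + - z)" by (simp add: right_diff_distrib)
    \<comment> \<open>The quotient was taken modulo the absolute value of \<open>n\<close>; the
      factor \<open>sgn n\<close> restores the sign.\<close>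
    also have "\<dots> = of_int n * (of_int (sgn n) * (y + - z))"
      by (simp add: sgn_if)
    finally show ?thesis using yz add uminus of_int_mult by blast
  qed
  with a that show ?thesis by blast
qed

end

text \<open>Since \<open>x\<close> is nonzero, factors of the indeterminate can be cancelled from an
  annihilating polynomial until the constant coefficient is nonzero. That coefficient is then an
  integer multiple of \<open>x\<close> in the ring generated by \<open>x\<close>.\<close>

lemma algebraic_int_nonzero_poly:
  assumes "algebraic_int x" "(x :: 'a :: field_char_0) \<noteq> 0"
  obtains p :: "int poly" where "Polynomial.coeff p 0 \<noteq> 0" "poly (map_poly of_int p) x = 0"
proof -
  have "\<exists>q :: int poly. Polynomial.coeff q 0 \<noteq> 0 \<and> poly (map_poly of_int q) x = 0"
    if "p \<noteq> 0" "poly (map_poly of_int p) x = 0" for p :: "int poly"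
    using that
  proof (induction p)
    case (pCons c q)
    show ?case
    proof (cases "c = 0")
      case True
      then show ?thesis using pCons assms(2) by (auto simp: map_poly_pCons)
    next
      case False
      then show ?thesis using pCons.prems by (intro exI[of _ "pCons c q"]) simp
    qed
  qed simp
  moreover obtain p :: "int poly" where "poly (map_poly of_int p) x = 0" "p \<noteq> 0"
    using assms(1) unfolding algebraic_int_altdef_ipoly by force
  ultimately show ?thesis using that by blast
qed

section \<open>Integers and units of a number field\<close>

locale complex_number_field =
  fixes F :: "complex set"
  assumes number_field: "number_field F"
begin

abbreviation integers :: "complex set" ("\<O>") where "\<O> \<equiv> ring_of_integers F"

lemma subfield: "subfield F complex_field"
  using number_field by (simp add: number_field_def)

lemmas field_closed = subfield_complexD[OF subfield]

lemma of_int_field: "of_int n \<in> F"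
  using Rats_subset_subfield[OF subfield] Rats_of_int by blast

lemma integers_field: "x \<in> \<O> \<Longrightarrow> x \<in> F"
  by (simp add: ring_of_integers_def)

lemma integers_algebraic: "x \<in> \<O> \<Longrightarrow> algebraic_int x"
  by (simp add: ring_of_integers_def)

lemma integers_of_int: "of_int n \<in> \<O>"
  by (auto simp: ring_of_integers_def of_int_field intro: int_imp_algebraic_int)

lemma integers_closed:
  shows "0 \<in> \<O>" "1 \<in> \<O>" "\<lbrakk>x \<in> \<O>; y \<in> \<O>\<rbrakk> \<Longrightarrow> x + y \<in> \<O>" "\<lbrakk>x \<in> \<O>; y \<in> \<O>\<rbrakk> \<Longrightarrow> x * y \<in> \<O>"
    "x \<in> \<O> \<Longrightarrow> - x \<in> \<O>" "\<lbrakk>x \<in> \<O>; y \<in> \<O>\<rbrakk> \<Longrightarrow> x - y \<in> \<O>"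
proof -
  show "0 \<in> \<O>" "1 \<in> \<O>" using integers_of_int[of 0] integers_of_int[of 1] by simp_all
  show add: "\<And>x y. \<lbrakk>x \<in> \<O>; y \<in> \<O>\<rbrakk> \<Longrightarrow> x + y \<in> \<O>" and "\<lbrakk>x \<in> \<O>; y \<in> \<O>\<rbrakk> \<Longrightarrow> x * y \<in> \<O>"
    and neg: "\<And>x. x \<in> \<O> \<Longrightarrow> - x \<in> \<O>"
    by (auto simp: ring_of_integers_def algebraic_int_add algebraic_int_mult field_closed)
  show "\<lbrakk>x \<in> \<O>; y \<in> \<O>\<rbrakk> \<Longrightarrow> x - y \<in> \<O>" using add neg by (metis diff_conv_add_uminus)
qed

text \<open>Multiplication by \<open>f\<close> has rational coefficients with respect to a spanning
  set. A common denominator \<open>N\<close> makes them integral, so \<open>N f\<close> preserves a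
  lattice and is an algebraic integer.\<close>

lemma integer_multiple:
  assumes f: "f \<in> F"
  obtains n :: int where "n > 0" "of_int n * f \<in> \<O>"
proof -
  obtain B where B: "finite B" "B \<subseteq> F" "F \<subseteq> rat_vs.span B" using number_field_span[OF number_field] .
  have "\<forall>b\<in>B. \<exists>n c. n > 0 \<and> of_int n * (f * b) = (\<Sum>v\<in>B. of_int (c v) * v)"
  proof
    fix b assume "b \<in> B"
    then have "f * b \<in> rat_vs.span B" using f B field_closed(4) by blast
    then show "\<exists>n c. n > 0 \<and> of_int n * (f * b) = (\<Sum>v\<in>B. of_int (c v) * v)"
      using span_common_denominator[OF B(1)] by metis
  qed
  then obtain n :: "complex \<Rightarrow> int" and c where
    n: "\<And>b. b \<in> B \<Longrightarrow> n b > 0" and c: "\<And>b. b \<in> B \<Longrightarrow> of_int (n b) * (f * b) = (\<Sum>v\<in>B. of_int (c b v) * v)"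
    by metis
  define N where "N = (\<Prod>b\<in>B. n b)"
  have N: "N > 0" unfolding N_def using n by (simp add: prod_pos)
  have stable: "of_int N * f * b \<in> int_span B" if b: "b \<in> B" for b
  proof -
    have "N = (N div n b) * n b" using dvd_prodI[OF B(1) b, of n] by (simp add: N_def)
    then have "(of_int N :: complex) = of_int (N div n b) * of_int (n b)" by (metis of_int_mult)
    then have "of_int N * f * b = of_int (N div n b) * (\<Sum>v\<in>B. of_int (c b v) * v)"
      using c[OF b] by (simp add: mult.assoc)
    also have "\<dots> = (\<Sum>v\<in>B. of_int (N div n b * c b v) * v)"
      by (simp add: sum_distrib_left mult.assoc)
    finally show ?thesis
      unfolding int_span_def by (intro CollectI exI[of _ "\<lambda>v. N div n b * c b v"] conjI TrueI)
  qed
  \<comment> \<open>The determinant trick needs a nonzero generator; one exists because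
    \<open>B\<close> spans 1.\<close>
  obtain v where v: "v \<in> B" "v \<noteq> 0"
  proof -
    have "\<not> B \<subseteq> {0}"
    proof
      assume "B \<subseteq> {0}"
      then have "rat_vs.span B \<subseteq> {0}" using rat_vs.span_mono[of B "{0}"] by simp
      then show False using B(3) field_closed(2) by auto
    qed
    with that show ?thesis by blast
  qed
  have "algebraic_int (of_int N * f)" by (rule algebraic_int_if_stable[OF B(1) v stable])
  then have "of_int N * f \<in> \<O>" using f by (simp add: ring_of_integers_def field_closed of_int_field)
  with N that show ?thesis by blast
qed

text \<open>Write an annihilating polynomial with nonzero constant coefficient as
  \<open>c + X q\<close>; then \<open>x * q(x) = - c\<close>.\<close>

lemma integer_divides_int:
  assumes x: "x \<in> \<O>" "x \<noteq> 0"
  obtains n :: int and y where "n \<noteq> 0" "y \<in> \<O>" "x * y = of_int n"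
proof -
  obtain p :: "int poly" where p: "Polynomial.coeff p 0 \<noteq> 0" "poly (map_poly of_int p) x = 0"
    using algebraic_int_nonzero_poly[OF integers_algebraic[OF x(1)] x(2)] .
  obtain c q where cq: "p = pCons c q" by (cases p)
  have poly: "poly (map_poly of_int r) x \<in> \<O>" for r :: "int poly"
    by (induction r) (auto simp: map_poly_pCons integers_closed integers_of_int x)
  have "of_int c + x * poly (map_poly of_int q) x = 0" using p cq by (simp add: map_poly_pCons)
  then have "x * poly (map_poly of_int q) x = of_int (- c)" by (simp add: eq_neg_iff_add_eq_0 add.commute)
  then show ?thesis using that[of "- c", OF _ poly] p cq by simp
qed

definition unit_set :: "complex set" where
  "unit_set = {x \<in> \<O>. x \<noteq> 0 \<and> inverse x \<in> \<O>}"

lemma carrier_integer_units: "carrier (integer_units F) = unit_set"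
proof -
  have "(\<exists>y\<in>\<O>. y * x = 1 \<and> x * y = 1) \<longleftrightarrow> x \<noteq> 0 \<and> inverse x \<in> \<O>" for x
    by (metis inverse_unique left_inverse mult.commute mult_zero_left zero_neq_one)
  then show ?thesis
    by (auto simp: integer_units_def units_of_def Units_def unit_set_def)
qed

lemma group_integer_units: "group (integer_units F)"
  unfolding integer_units_def
  by (rule monoid.units_group, rule monoidI) (auto simp: integers_closed mult.assoc)

lemma one_integer_units: "\<one>\<^bsub>integer_units F\<^esub> = 1"
  by (simp add: integer_units_def units_of_def)

text \<open>Otherwise the trivial group would be a finite-index group of units inside \<open>\<rat>\<close>.\<close>
lemma infinite_unit_set:
  assumes "F \<noteq> \<rat>"
    and no_subfield: "\<not> (\<exists>K H. subfield K complex_field \<and> K \<subset> F \<and>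
                 finite_index_subgroup H (integer_units F) \<and> H \<subseteq> K)"
  shows "infinite unit_set"
proof
  assume fin: "finite unit_set"
  have "subgroup {1} (integer_units F)"
    using group.triv_subgroup[OF group_integer_units] by (simp add: one_integer_units)
  moreover have "finite (rcosets\<^bsub>integer_units F\<^esub> {1})"
    unfolding RCOSETS_def carrier_integer_units using fin by simp
  ultimately have "finite_index_subgroup {1} (integer_units F)" by (simp add: finite_index_subgroup_def)
  then show False
    using no_subfield subfield_complex_Rats Rats_subset_subfield[OF subfield] assms(1)
    by (metis Rats_1 empty_subsetI insert_subset psubsetI)
qed

text \<open>These contain all quotients of units from one residue class.\<close>
lemma infinite_congruent_units:
  assumes inf: "infinite unit_set" and d: "d \<in> \<O>" "d \<noteq> 0"
  shows "infinite {w \<in> unit_set. \<exists>y\<in>\<O>. \<exists>z\<in>\<O>. w = 1 + d * y \<and> inverse w = 1 + d * z}"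
proof -
  obtain B where B: "finite B" "B \<subseteq> F" "F \<subseteq> rat_vs.span B" using number_field_span[OF number_field] .
  interpret finite_rank_subgroup \<O> B
    by unfold_locales (use B integers_field in \<open>auto simp: integers_closed\<close>)
  \<comment> \<open>Congruence modulo a nonzero integer multiple \<open>n\<close> of
    \<open>d\<close> implies congruence modulo \<open>d\<close>, and the finite quotients are
    available for integers.\<close>
  obtain n d' where n: "n \<noteq> 0" and d': "d' \<in> \<O>" "d * d' = of_int n" using integer_divides_int[OF d] .
  obtain S where S: "infinite S" "S \<subseteq> unit_set"
    "\<And>s t. \<lbrakk>s \<in> S; t \<in> S\<rbrakk> \<Longrightarrow> \<exists>y\<in>\<O>. s - t = of_int n * y"
    using infinite_congruent_subset[OF n inf] unfolding unit_set_def by blast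
  then obtain t where t: "t \<in> S" by (metis ex_in_conv finite.emptyI)
  have unit: "s \<in> \<O>" "s \<noteq> 0" "inverse s \<in> \<O>" if "s \<in> S" for s using S(2) that by (auto simp: unit_set_def)
  have "(\<lambda>s. s * inverse t) ` S \<subseteq> {w \<in> unit_set. \<exists>y\<in>\<O>. \<exists>z\<in>\<O>. w = 1 + d * y \<and> inverse w = 1 + d * z}"
  proof (rule image_subsetI)
    fix s assume s: "s \<in> S"
    have div: "\<exists>y\<in>\<O>. u * inverse v = 1 + d * y" if u: "u \<in> S" and v: "v \<in> S" for u v
    proof -
      obtain y where y: "y \<in> \<O>" "u - v = of_int n * y" using S(3)[OF u v] by blast
      have "u * inverse v = 1 + (u - v) * inverse v" using unit[OF v] by (simp add: field_simps)
      also have "\<dots> = 1 + d * (d' * y * inverse v)" by (simp add: y d'(2)[symmetric])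
      finally have "u * inverse v = 1 + d * (d' * y * inverse v)" .
      moreover have "d' * y * inverse v \<in> \<O>" using y d' unit[OF v] by (simp add: integers_closed)
      ultimately show ?thesis by (rule bexI)
    qed
    have "s * inverse t \<in> unit_set"
      using unit[OF s] unit[OF t] by (simp add: unit_set_def integers_closed)
    moreover have "inverse (s * inverse t) = t * inverse s" by (simp add: mult.commute)
    ultimately show "s * inverse t \<in> {w \<in> unit_set. \<exists>y\<in>\<O>. \<exists>z\<in>\<O>. w = 1 + d * y \<and> inverse w = 1 + d * z}"
      using div[OF s t] div[OF t s] by (simp add: mult.commute)
  qed
  moreover have "inj_on (\<lambda>s. s * inverse t) S" using unit[OF t] by (auto simp: inj_on_def)
  ultimately show ?thesis using S(1) finite_imageD finite_subset by blast
qed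

end

section \<open>Transvections and diagonal elements of SL(2)\<close>

definition mat2 :: "'a \<Rightarrow> 'a \<Rightarrow> 'a \<Rightarrow> 'a \<Rightarrow> 'a mat" where
  "mat2 a b c d = Matrix.mat 2 2 (\<lambda>(i, j). if i = 0 then if j = 0 then a else b else if j = 0 then c else d)"

lemma mat2_carrier [simp]: "mat2 a b c d \<in> carrier_mat 2 2"
  by (simp add: mat2_def)

lemma mat2_index [simp]:
  "mat2 a b c d $$ (0, 0) = a" "mat2 a b c d $$ (0, Suc 0) = b"
  "mat2 a b c d $$ (Suc 0, 0) = c" "mat2 a b c d $$ (Suc 0, Suc 0) = d"
  by (simp_all add: mat2_def)

lemma eq_mat2:
  assumes "A \<in> carrier_mat 2 2"
  shows "A = mat2 (A $$ (0, 0)) (A $$ (0, 1)) (A $$ (1, 0)) (A $$ (1, 1))"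
  by (rule eq_matI) (use assms in \<open>auto simp: mat2_def less_2_cases_iff\<close>)

lemma mat2_eq_iff [simp]: "mat2 a b c d = mat2 a' b' c' d' \<longleftrightarrow> a = a' \<and> b = b' \<and> c = c' \<and> d = d'"
  by (metis mat2_index)

lemma mat2_mult [simp]:
  fixes a :: "'a::comm_ring_1"
  shows "mat2 a b c d * mat2 a' b' c' d' =
    mat2 (a * a' + b * c') (a * b' + b * d') (c * a' + d * c') (c * b' + d * d')"
  by (rule eq_matI) (auto simp: mat2_def scalar_prod_def less_2_cases_iff numeral_2_eq_2)

lemma one_mat2: "1\<^sub>m 2 = mat2 1 0 0 1"
  by (rule eq_matI) (auto simp: mat2_def less_2_cases_iff)

lemma det_mat2 [simp]:
  fixes a :: "'a::comm_ring_1"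
  shows "det (mat2 a b c d) = a * d - b * c"
proof -
  have "det (mat2 a b c d) = (\<Sum>i<2. mat2 a b c d $$ (i, 0) * cofactor (mat2 a b c d) i 0)"
    by (rule laplace_expansion_column) simp_all
  moreover have "mat_delete (mat2 a b c d) 0 0 = Matrix.mat 1 1 (\<lambda>_. d)"
    "mat_delete (mat2 a b c d) 1 0 = Matrix.mat 1 1 (\<lambda>_. b)"
    by (rule eq_matI; auto simp: mat_delete_def mat2_def)+
  ultimately show ?thesis
    by (simp add: numeral_2_eq_2 cofactor_def det_single algebra_simps)
qed

lemma elements_mat2 [simp]: "elements_mat (mat2 a b c d) = {a, b, c, d}"
  by (auto simp: elements_mat_def mat2_def numeral_2_eq_2)

lemma carrier_SL2:
  "carrier (SL 2 R) = {mat2 a b c d | a b c d. a \<in> R \<and> b \<in> R \<and> c \<in> R \<and> d \<in> R \<and> a * d - b * c = 1}"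
proof (intro equalityI subsetI)
  fix A assume "A \<in> carrier (SL 2 R)"
  then have A: "A \<in> carrier_mat 2 2" "elements_mat A \<subseteq> R" "det A = 1" by (auto simp: SL_def)
  from eq_mat2[OF A(1)] obtain a b c d where "A = mat2 a b c d" by metis
  with A show "A \<in> {mat2 a b c d | a b c d. a \<in> R \<and> b \<in> R \<and> c \<in> R \<and> d \<in> R \<and> a * d - b * c = 1}"
    by auto
qed (auto simp: SL_def)

lemma mat2_in_SL2 [simp]:
  "mat2 a b c d \<in> carrier (SL 2 R) \<longleftrightarrow> a \<in> R \<and> b \<in> R \<and> c \<in> R \<and> d \<in> R \<and> a * d - b * c = 1"
  by (simp add: carrier_SL2)

lemma SL_simps [simp]: "mult (SL n R) = (*)" "one (SL n R) = 1\<^sub>m n"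
  by (simp_all add: SL_def)

lemma group_SL2:
  fixes R :: "'a::comm_ring_1 set"
  assumes "0 \<in> R" "1 \<in> R" "\<And>x y. \<lbrakk>x \<in> R; y \<in> R\<rbrakk> \<Longrightarrow> x + y \<in> R" "\<And>x y. \<lbrakk>x \<in> R; y \<in> R\<rbrakk> \<Longrightarrow> x * y \<in> R"
    "\<And>x. x \<in> R \<Longrightarrow> - x \<in> R"
  shows "group (SL 2 R)"
proof (rule groupI)
  fix A B C assume A: "A \<in> carrier (SL 2 R)" and B: "B \<in> carrier (SL 2 R)"
  then obtain a b c d a' b' c' d' where *: "A = mat2 a b c d" "a \<in> R" "b \<in> R" "c \<in> R" "d \<in> R" "a * d - b * c = 1"
    "B = mat2 a' b' c' d'" "a' \<in> R" "b' \<in> R" "c' \<in> R" "d' \<in> R" "a' * d' - b' * c' = 1"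
    by (auto simp: carrier_SL2)
  have "(a * a' + b * c') * (c * b' + d * d') - (a * b' + b * d') * (c * a' + d * c')
      = (a * d - b * c) * (a' * d' - b' * c')" by (simp add: algebra_simps)
  then show "A \<otimes>\<^bsub>SL 2 R\<^esub> B \<in> carrier (SL 2 R)"
    using * assms by (auto simp: carrier_SL2)
  show "\<one>\<^bsub>SL 2 R\<^esub> \<otimes>\<^bsub>SL 2 R\<^esub> A = A" by (simp add: * one_mat2)
  have "mat2 d (- b) (- c) a \<in> carrier (SL 2 R)" using * assms by (auto simp: carrier_SL2 algebra_simps)
  moreover have "mat2 d (- b) (- c) a * A = 1\<^sub>m 2"
    using *(6) by (simp add: *(1) one_mat2 algebra_simps)
  ultimately show "\<exists>B\<in>carrier (SL 2 R). B \<otimes>\<^bsub>SL 2 R\<^esub> A = \<one>\<^bsub>SL 2 R\<^esub>" by auto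
  assume "C \<in> carrier (SL 2 R)"
  then show "A \<otimes>\<^bsub>SL 2 R\<^esub> B \<otimes>\<^bsub>SL 2 R\<^esub> C = A \<otimes>\<^bsub>SL 2 R\<^esub> (B \<otimes>\<^bsub>SL 2 R\<^esub> C)"
    using * by (auto simp: carrier_SL2 algebra_simps)
qed (use assms in \<open>auto simp: carrier_SL2 one_mat2\<close>)

text \<open>Vectors of the plane are pairs rather than \<open>vec\<close>, which avoids dimension
  side conditions.\<close>

definition scale2 :: "complex \<Rightarrow> complex \<times> complex \<Rightarrow> complex \<times> complex" where
  "scale2 c v = (c * fst v, c * snd v)"

definition mv2 :: "complex mat \<Rightarrow> complex \<times> complex \<Rightarrow> complex \<times> complex" where
  "mv2 A v = (A $$ (0, 0) * fst v + A $$ (0, 1) * snd v, A $$ (1, 0) * fst v + A $$ (1, 1) * snd v)"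

text \<open>The determinant with columns \<open>v\<close> and \<open>w\<close>; it is nonzero
  exactly when they form a basis.\<close>

definition wedge :: "complex \<times> complex \<Rightarrow> complex \<times> complex \<Rightarrow> complex" where
  "wedge v w = fst v * snd w - snd v * fst w"

text \<open>The matrix of \<open>x \<mapsto> x + s (v \<wedge> x) v\<close>.\<close>
definition transv :: "complex \<times> complex \<Rightarrow> complex \<Rightarrow> complex mat" where
  "transv v s = mat2 (1 - s * fst v * snd v) (s * (fst v)\<^sup>2) (- s * (snd v)\<^sup>2) (1 + s * fst v * snd v)"

lemma mv2_mat2 [simp]: "mv2 (mat2 a b c d) v = (a * fst v + b * snd v, c * fst v + d * snd v)"
  by (simp add: mv2_def)

lemma mv2_mult:
  assumes "A \<in> carrier_mat 2 2" "B \<in> carrier_mat 2 2"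
  shows "mv2 (A * B) v = mv2 A (mv2 B v)"
proof -
  obtain a b c d a' b' c' d' where "A = mat2 a b c d" "B = mat2 a' b' c' d'"
    using eq_mat2 assms by metis
  then show ?thesis by (simp add: algebra_simps)
qed

lemma mv2_one [simp]: "mv2 (1\<^sub>m 2) v = v"
  by (simp add: one_mat2)

lemma mv2_scale2: "mv2 A (scale2 c v) = scale2 c (mv2 A v)"
  by (simp add: mv2_def scale2_def algebra_simps)

lemma scale2_scale2 [simp]: "scale2 c (scale2 d v) = scale2 (c * d) v"
  by (simp add: scale2_def)

lemma scale2_one [simp]: "scale2 1 v = v"
  by (simp add: scale2_def)

lemma scale2_right_cancel: "v \<noteq> (0, 0) \<Longrightarrow> scale2 c v = scale2 d v \<longleftrightarrow> c = d"
  by (cases v) (auto simp: scale2_def)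

lemma transv_zero [simp]: "transv v 0 = 1\<^sub>m 2"
  by (simp add: transv_def one_mat2)

lemma transv_add: "transv v (s + t) = transv v s * transv v t"
  by (simp add: transv_def power2_eq_square algebra_simps)

lemma transv_scale2: "transv (scale2 c v) s = transv v (c\<^sup>2 * s)"
  by (simp add: transv_def scale2_def power2_eq_square algebra_simps)

lemma transv_carrier [simp]: "transv v s \<in> carrier_mat 2 2"
  by (simp add: transv_def)

lemma transv_inject: "v \<noteq> (0, 0) \<Longrightarrow> transv v s = transv v t \<longleftrightarrow> s = t"
  by (cases v) (auto simp: transv_def)

text \<open>\<open>A\<close> has determinant 1 and so preserves \<open>wedge\<close>. Hence it sends
  \<open>x + s * wedge v x * v\<close> to \<open>Ax + s * wedge (Av) (Ax) * Av\<close>.\<close>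

lemma transv_conj:
  assumes "A \<in> carrier (SL 2 R)"
  shows "A * transv v s = transv (mv2 A v) s * A"
proof -
  obtain a b c d where A: "A = mat2 a b c d" and det: "a * d = 1 + b * c"
    using assms by (auto simp: carrier_SL2 algebra_simps)
  obtain p q where v: "v = (p, q)" by (cases v)
  define P Q where "P = a * p + b * q" and "Q = c * p + d * q"
  \<comment> \<open>These are the coordinates of \<open>v\<close>, recovered from
    \<open>(P, Q)\<close> by the inverse of \<open>A\<close>.\<close>
  have "c * P - a * Q = - q" "d * P - b * Q = p"
    unfolding P_def Q_def using arg_cong[OF det, of "\<lambda>t. t * q"] arg_cong[OF det, of "\<lambda>t. t * p"]
    by (simp_all add: algebra_simps)
  then have key: "c * P = a * Q - q" "d * P = b * Q + p" by (simp_all add: algebra_simps)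
  have "(1 - s * P * Q) * a + s * P\<^sup>2 * c = a + s * P * (c * P - a * Q)"
    "(1 - s * P * Q) * b + s * P\<^sup>2 * d = b + s * P * (d * P - b * Q)"
    "- s * Q\<^sup>2 * a + (1 + s * P * Q) * c = c + s * Q * (c * P - a * Q)"
    "- s * Q\<^sup>2 * b + (1 + s * P * Q) * d = d + s * Q * (d * P - b * Q)"
    by (simp_all only: power2_eq_square) (simp_all add: algebra_simps)
  then have "(1 - s * P * Q) * a + s * P\<^sup>2 * c = a * (1 - s * p * q) + b * (- s * q\<^sup>2)"
    "(1 - s * P * Q) * b + s * P\<^sup>2 * d = a * (s * p\<^sup>2) + b * (1 + s * p * q)"
    "- s * Q\<^sup>2 * a + (1 + s * P * Q) * c = c * (1 - s * p * q) + d * (- s * q\<^sup>2)"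
    "- s * Q\<^sup>2 * b + (1 + s * P * Q) * d = c * (s * p\<^sup>2) + d * (1 + s * p * q)"
    unfolding key by (simp_all add: P_def Q_def power2_eq_square algebra_simps)
  then show ?thesis by (simp add: A v transv_def P_def[symmetric] Q_def[symmetric])
qed

text \<open>In the basis \<open>v\<close>, \<open>u\<close> the matrix is diagonal with entries
  \<open>w\<close> and \<open>w'\<close>. The change of basis introduces the denominator
  \<open>wedge v u\<close>, which cancels because \<open>w\<close> and \<open>w'\<close> are
  congruent to 1 modulo it.\<close>

lemma diagonal_in_SL2:
  fixes R :: "complex set"
  assumes R: "1 \<in> R" "\<And>x y. \<lbrakk>x \<in> R; y \<in> R\<rbrakk> \<Longrightarrow> x + y \<in> R" "\<And>x y. \<lbrakk>x \<in> R; y \<in> R\<rbrakk> \<Longrightarrow> x * y \<in> R"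
    "\<And>x. x \<in> R \<Longrightarrow> - x \<in> R"
    and v: "fst v \<in> R" "snd v \<in> R" and u: "fst u \<in> R" "snd u \<in> R" and d: "wedge v u \<noteq> 0"
    and w: "w * w' = 1" "w = 1 + wedge v u * y" "w' = 1 + wedge v u * z" "y \<in> R" "z \<in> R"
  shows "\<exists>A\<in>carrier (SL 2 R). mv2 A v = scale2 w v \<and> mv2 A u = scale2 w' u"
proof -
  obtain p q where pq: "v = (p, q)" by (cases v)
  obtain r s where rs: "u = (r, s)" by (cases u)
  define D where "D = wedge v u"
  have D: "D = p * s - q * r" by (simp add: D_def wedge_def pq rs)
  have D0: "D \<noteq> 0" using d by (simp add: D_def)
  have mem: "p \<in> R" "q \<in> R" "r \<in> R" "s \<in> R" using v u by (simp_all add: pq rs)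
  \<comment> \<open>The matrix of \<open>x\<close> to
    \<open>x + y * wedge x u * v + z * wedge v x * u\<close>.\<close>
  let ?A = "mat2 (1 + y * p * s + - (z * q * r)) (z * p * r + - (y * p * r)) (y * q * s + - (z * q * s)) (1 + z * p * s + - (y * q * r))"
  have ww: "y + z + D * y * z = 0"
  proof -
    \<comment> \<open>This is \<open>w * w' = 1\<close> with \<open>w = 1 + D y\<close> and
      \<open>w' = 1 + D z\<close> expanded.\<close>
    have "D * (y + z + D * y * z) = 0" using w by (simp add: D_def[symmetric] algebra_simps)
    then show ?thesis using D0 by simp
  qed
  have det: "(1 + y * p * s + - (z * q * r)) * (1 + z * p * s + - (y * q * r)) - (z * p * r + - (y * p * r)) * (y * q * s + - (z * q * s)) = 1 + D * (y + z + D * y * z)"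
    unfolding D by (simp add: algebra_simps power2_eq_square)
  have "?A \<in> carrier (SL 2 R)"
    unfolding mat2_in_SL2 by (intro conjI R mem w) (simp only: det ww mult_zero_right add_0_right)
  moreover have "mv2 ?A v = scale2 w v" "mv2 ?A u = scale2 w' u"
    unfolding w D_def[symmetric] by (simp_all add: pq rs scale2_def D algebra_simps)
  ultimately show ?thesis by blast
qed

section \<open>Abelian groups acting on the line\<close>

text \<open>The group \<open>L\<close> sits inside a ring so that conjugation by a normalizing map
  can be written as multiplication by a ring element \<alpha>.\<close>

locale additive_line_action =
  fixes L :: "'a::comm_ring_1 set" and \<rho> :: "'a \<Rightarrow> real \<Rightarrow> real"
  assumes zero_mem: "0 \<in> L"
    and add_mem: "\<lbrakk>s \<in> L; t \<in> L\<rbrakk> \<Longrightarrow> s + t \<in> L"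
    and uminus_mem: "s \<in> L \<Longrightarrow> - s \<in> L"
    and strict_mono_act: "s \<in> L \<Longrightarrow> strict_mono (\<rho> s)"
    and act_add: "\<lbrakk>s \<in> L; t \<in> L\<rbrakk> \<Longrightarrow> \<rho> (s + t) x = \<rho> s (\<rho> t x)"
    and act_zero: "\<rho> 0 x = x"
begin

text \<open>When nonempty, this set is closed upwards and invariant under \<open>L\<close>; it
  stands in for a neighbourhood of plus infinity.\<close>

definition unbounded_points :: "real set" where
  "unbounded_points = {x. \<forall>M. \<exists>s\<in>L. M < \<rho> s x}"

definition rightward :: "'a set" where
  "rightward = {s \<in> L. \<forall>x\<in>unbounded_points. x < \<rho> s x}"

text \<open>If an orbit is unbounded above, these elements form a subgroup; every other element of
  \<open>L\<close> moves all \<open>unbounded_points\<close> in one direction.\<close>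

definition infinitesimal :: "'a set" where
  "infinitesimal = {s \<in> L. \<exists>x\<in>unbounded_points. \<rho> s x = x}"

lemma act_less_iff: "s \<in> L \<Longrightarrow> \<rho> s x < \<rho> s y \<longleftrightarrow> x < y"
  by (simp add: strict_mono_act strict_mono_less)

lemma act_le_iff: "s \<in> L \<Longrightarrow> \<rho> s x \<le> \<rho> s y \<longleftrightarrow> x \<le> y"
  by (simp add: strict_mono_act strict_mono_less_eq)

lemma act_minus_act [simp]: "s \<in> L \<Longrightarrow> \<rho> (- s) (\<rho> s x) = x"
  by (metis act_add act_zero add.left_inverse uminus_mem)

lemma act_act_minus [simp]: "s \<in> L \<Longrightarrow> \<rho> s (\<rho> (- s) x) = x"
  by (metis act_minus_act add.inverse_inverse uminus_mem)

lemma act_commute: "\<lbrakk>s \<in> L; t \<in> L\<rbrakk> \<Longrightarrow> \<rho> s (\<rho> t x) = \<rho> t (\<rho> s x)"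
  by (metis act_add add.commute)

lemma diff_mem: "\<lbrakk>s \<in> L; t \<in> L\<rbrakk> \<Longrightarrow> s - t \<in> L"
  by (metis add_mem uminus_mem uminus_add_conv_diff add.commute)

lemma of_nat_mult_mem: "s \<in> L \<Longrightarrow> of_nat n * s \<in> L"
  by (induction n) (auto simp: zero_mem add_mem distrib_right)

lemma of_int_mult_mem: "s \<in> L \<Longrightarrow> of_int n * s \<in> L"
  by (cases n rule: int_cases2) (auto simp: of_nat_mult_mem intro: uminus_mem)

lemma act_of_nat: "s \<in> L \<Longrightarrow> \<rho> (of_nat n * s) x = (\<rho> s ^^ n) x"
  by (induction n) (auto simp: act_zero distrib_right act_add of_nat_mult_mem)

lemma unbounded_points_up:
  assumes x: "x \<in> unbounded_points" and le: "x \<le> y"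
  shows "y \<in> unbounded_points"
  unfolding unbounded_points_def
proof (rule CollectI, rule allI)
  fix M
  obtain s where s: "s \<in> L" "M < \<rho> s x" using x unfolding unbounded_points_def by blast
  then have "M < \<rho> s y" using le act_le_iff[of s x y] by linarith
  then show "\<exists>s\<in>L. M < \<rho> s y" using s by blast
qed

lemma unbounded_points_act: "\<lbrakk>x \<in> unbounded_points; s \<in> L\<rbrakk> \<Longrightarrow> \<rho> s x \<in> unbounded_points"
proof -
  assume x: "x \<in> unbounded_points" and s: "s \<in> L"
  show ?thesis
    unfolding unbounded_points_def
  proof (rule CollectI, rule allI)
    fix M
    obtain t where t: "t \<in> L" "M < \<rho> t x" using x unfolding unbounded_points_def by blast
    have "\<rho> (t - s) (\<rho> s x) = \<rho> t x"
      using act_add[of "t - s" s x] diff_mem s t by simp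
    then show "\<exists>t\<in>L. M < \<rho> t (\<rho> s x)" using t diff_mem[OF t(1) s] by metis
  qed
qed

text \<open>If an increasing map moves \<open>x\<close> to one side, all its positive iterates move
  \<open>x\<close> to the same side.\<close>

lemma act_of_nat_mult_fixed:
  assumes s: "s \<in> L" and n: "n > 0" and fixed: "\<rho> (of_nat n * s) x = x"
  shows "\<rho> s x = x"
proof (rule ccontr)
  assume "\<rho> s x \<noteq> x"
  then consider "x < \<rho> s x" | "\<rho> s x < x" by linarith
  then show False
  proof cases
    case 1
    have "x < (\<rho> s ^^ Suc k) x" for k
    proof (induction k)
      case (Suc k)
      then have "\<rho> s x < \<rho> s ((\<rho> s ^^ Suc k) x)" by (simp only: act_less_iff[OF s])
      with 1 show ?case by simp
    qed (use 1 in simp)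
    from this[of "n - 1"] show False using fixed n by (simp add: act_of_nat[OF s] del: funpow.simps)
  next
    case 2
    have "(\<rho> s ^^ Suc k) x < x" for k
    proof (induction k)
      case (Suc k)
      then have "\<rho> s ((\<rho> s ^^ Suc k) x) < \<rho> s x" by (simp only: act_less_iff[OF s])
      with 2 show ?case by simp
    qed (use 2 in simp)
    from this[of "n - 1"] show False using fixed n by (simp add: act_of_nat[OF s] del: funpow.simps)
  qed
qed

lemma act_of_nat_fixed: "\<lbrakk>s \<in> L; \<rho> s x = x\<rbrakk> \<Longrightarrow> \<rho> (of_nat n * s) x = x"
  by (simp add: act_of_nat) (induction n, auto)

lemma act_minus_fixed: "\<lbrakk>s \<in> L; \<rho> s x = x\<rbrakk> \<Longrightarrow> \<rho> (- s) x = x"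
  by (metis act_minus_act)

lemma act_of_int_fixed: "\<lbrakk>s \<in> L; \<rho> s x = x\<rbrakk> \<Longrightarrow> \<rho> (of_int n * s) x = x"
  by (cases n rule: int_cases2) (auto simp: act_of_nat_fixed of_nat_mult_mem intro: act_minus_fixed)

lemma act_of_int_mult_fixed:
  assumes s: "s \<in> L" and n: "n \<noteq> 0" and fixed: "\<rho> (of_int n * s) x = x"
  shows "\<rho> s x = x"
proof (cases n rule: int_cases2)
  case (nonneg m)
  then show ?thesis using act_of_nat_mult_fixed[OF s, of m x] n fixed by simp
next
  case (nonpos m)
  then have "\<rho> (- of_int n * s) x = x"
    using act_minus_fixed[OF of_int_mult_mem[OF s] fixed] by simp
  then show ?thesis using act_of_nat_mult_fixed[OF s, of m x] n nonpos by simp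
qed

text \<open>The orbit of \<open>p\<close> under the multiples of \<open>t\<close> is invariant under
  \<open>t\<close> and, by commutativity, under every \<open>s\<close> that fixes \<open>p\<close>.
  Increasing bijections that preserve a set fix its supremum, so no appeal to continuity is
  made.\<close>

lemma Sup_orbit_fixed:
  assumes t: "t \<in> L" and bdd: "bdd_above (range (\<lambda>n. \<rho> (of_int n * t) p))"
    and s: "s \<in> L" "s = t \<or> \<rho> s p = p"
  shows "\<rho> s (Sup (range (\<lambda>n. \<rho> (of_int n * t) p))) = Sup (range (\<lambda>n. \<rho> (of_int n * t) p))"
proof -
  define S where "S = range (\<lambda>n. \<rho> (of_int n * t) p)"
  have bddS: "bdd_above S" and ne: "S \<noteq> {}" using bdd by (auto simp: S_def)
  have shift: "\<rho> t (\<rho> (of_int n * t) p) = \<rho> (of_int (n + 1) * t) p"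
    "\<rho> (- t) (\<rho> (of_int n * t) p) = \<rho> (of_int (n - 1) * t) p" for n
    using act_add[of t "of_int n * t" p] act_add[of "- t" "of_int n * t" p]
    by (simp_all add: t of_int_mult_mem uminus_mem distrib_right left_diff_distrib add.commute)
  have inv: "\<rho> s y \<in> S" "\<rho> (- s) y \<in> S" if "y \<in> S" for y
  proof -
    from that obtain n where n: "y = \<rho> (of_int n * t) p" by (auto simp: S_def)
    have mem: "\<rho> (of_int k * t) p \<in> S" for k by (auto simp: S_def)
    from s(2) show "\<rho> s y \<in> S" "\<rho> (- s) y \<in> S"
    proof (atomize (full), elim disjE)
      assume "s = t"
      then show "\<rho> s y \<in> S \<and> \<rho> (- s) y \<in> S"
        by (simp only: n shift mem simp_thms)
    next
      assume "\<rho> s p = p"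
      then have "\<rho> s y = y" "\<rho> (- s) y = y"
        using act_commute[of s "of_int n * t" p] act_commute[of "- s" "of_int n * t" p]
          act_minus_fixed[of s p] s t
        by (simp_all add: n uminus_mem of_int_mult_mem)
      then show "\<rho> s y \<in> S \<and> \<rho> (- s) y \<in> S" using that by simp
    qed
  qed
  \<comment> \<open>Taking both \<open>s\<close> and \<open>- s\<close> for \<open>u\<close> gives
    the two inequalities of the fixed-point equation.\<close>
  have 1: "Sup S \<le> \<rho> u (Sup S)" if u: "u = s \<or> u = - s" for u
  proof (rule cSup_least[OF ne])
    fix y assume y: "y \<in> S"
    have uL: "u \<in> L" "- u \<in> L" using u s(1) uminus_mem by auto
    have "\<rho> (- u) y \<in> S" using u inv[OF y] by auto
    then have "\<rho> (- u) y \<le> Sup S" using bddS by (rule cSup_upper)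
    then have "\<rho> u (\<rho> (- u) y) \<le> \<rho> u (Sup S)" by (simp only: act_le_iff[OF uL(1)])
    then show "y \<le> \<rho> u (Sup S)" by (simp only: act_act_minus[OF uL(1)])
  qed
  have "\<rho> s (Sup S) \<le> \<rho> s (\<rho> (- s) (Sup S))"
    using 1[of "- s"] by (simp only: act_le_iff[OF s(1)] simp_thms)
  then have "\<rho> s (Sup S) \<le> Sup S" by (simp only: act_act_minus[OF s(1)])
  with 1[of s] show ?thesis unfolding S_def by simp
qed

lemma mem_Sup_orbit:
  assumes "bdd_above (range (\<lambda>n. \<rho> (of_int n * t) p))" "p \<in> unbounded_points"
  shows "Sup (range (\<lambda>n. \<rho> (of_int n * t) p)) \<in> unbounded_points"
proof -
  have "p \<le> Sup (range (\<lambda>n. \<rho> (of_int n * t) p))"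
    by (rule cSup_upper[OF _ assms(1)]) (rule range_eqI[of _ _ 0], simp add: act_zero)
  then show ?thesis by (rule unbounded_points_up[OF assms(2)])
qed

text \<open>Induction on \<open>B\<close>: let \<open>p\<close> be fixed by the earlier elements.
  The orbit of \<open>p\<close> under the new element \<open>t\<close> is bounded, and its supremum
  is fixed by \<open>t\<close> and by all the earlier elements.\<close>

lemma common_fixed_point:
  assumes "finite B" "B \<subseteq> infinitesimal" and ne: "unbounded_points \<noteq> {}"
  shows "\<exists>p\<in>unbounded_points. \<forall>s\<in>B. \<rho> s p = p"
  using assms(1,2)
proof (induction B rule: finite_induct)
  case empty
  then show ?case using ne by blast
next
  case (insert t B)
  then obtain p where p: "p \<in> unbounded_points" "\<forall>s\<in>B. \<rho> s p = p" by blast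
  have B: "s \<in> L" if "s \<in> insert t B" for s
    using that insert.prems unfolding infinitesimal_def by blast
  then have t: "t \<in> L" by blast
  obtain z where z: "z \<in> unbounded_points" "\<rho> t z = z"
    using insert.prems unfolding infinitesimal_def by blast
  \<comment> \<open>A translate of the fixed point \<open>z\<close> of \<open>t\<close> lies above
    \<open>p\<close>. By commutativity \<open>t\<close> fixes it too, so it bounds the
    \<open>t\<close>-orbit of \<open>p\<close>.\<close>
  obtain u where u: "u \<in> L" "p < \<rho> u z" using z unfolding unbounded_points_def by blast
  have le: "\<rho> (of_int n * t) p \<le> \<rho> u z" for n
  proof -
    have "\<rho> (of_int n * t) (\<rho> u z) = \<rho> u z"
      using act_commute[OF of_int_mult_mem[OF t] u(1)] act_of_int_fixed[OF t z(2)] by metis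
    then show ?thesis
      using act_le_iff[OF of_int_mult_mem[OF t], of n p "\<rho> u z"] u by linarith
  qed
  then have bdd: "bdd_above (range (\<lambda>n. \<rho> (of_int n * t) p))"
    by (intro bdd_aboveI[of _ "\<rho> u z"]) blast
  have "\<rho> s (Sup (range (\<lambda>n. \<rho> (of_int n * t) p))) = Sup (range (\<lambda>n. \<rho> (of_int n * t) p))"
    if "s \<in> insert t B" for s
    using that p(2) by (intro Sup_orbit_fixed[OF t bdd B[OF that]]) blast
  then show ?case by (intro bexI[OF _ mem_Sup_orbit[OF bdd p(1)]] ballI)
qed

lemma iterate_ge:
  assumes t: "t \<in> L" and x: "x \<le> \<rho> t x"
  shows "x \<le> (\<rho> t ^^ n) x"
proof (induction n)
  case (Suc n)
  then have "\<rho> t x \<le> \<rho> t ((\<rho> t ^^ n) x)" by (simp add: act_le_iff t)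
  with x show ?case by simp
qed simp

text \<open>Since \<open>t\<close> does not move \<open>x\<close> to the left, backward iterates
  stay below \<open>x\<close>. The full orbit is thus bounded above, and its supremum is a fixed
  point.\<close>

lemma infinitesimal_if_bounded:
  assumes t: "t \<in> L" and x: "x \<in> unbounded_points" "x \<le> \<rho> t x"
    and le: "\<And>n. \<rho> (of_nat n * t) x \<le> M"
  shows "t \<in> infinitesimal"
proof -
  have "\<rho> (of_int n * t) x \<le> M" for n
  proof (cases n rule: int_cases2)
    case (nonneg m)
    then show ?thesis using le[of m] by simp
  next
    case (nonpos m)
    have mem: "of_nat m * t \<in> L" by (rule of_nat_mult_mem[OF t])
    have "x \<le> \<rho> (of_nat m * t) x" using iterate_ge[OF t x(2)] by (simp add: act_of_nat t)
    then have "\<rho> (- (of_nat m * t)) x \<le> \<rho> (- (of_nat m * t)) (\<rho> (of_nat m * t) x)"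
      by (simp only: act_le_iff uminus_mem mem)
    also have "\<dots> = x" by (rule act_minus_act[OF mem])
    also have "x \<le> M" using le[of 0] by (simp add: act_zero)
    finally show ?thesis using nonpos by simp
  qed
  then have bdd: "bdd_above (range (\<lambda>n. \<rho> (of_int n * t) x))" by (intro bdd_aboveI[of _ M]) blast
  have "\<exists>z\<in>unbounded_points. \<rho> t z = z"
    by (rule bexI[OF _ mem_Sup_orbit[OF bdd x(1)]], rule Sup_orbit_fixed[OF t bdd t]) simp
  then show ?thesis using t by (simp add: infinitesimal_def)
qed

text \<open>If neither \<open>s\<close> nor \<open>- s\<close> were rightward, \<open>s\<close>
  would move some points weakly right and others weakly left, and an orbit would be trapped between
  two such points.\<close>

lemma not_infinitesimal_cases:
  assumes s: "s \<in> L" "s \<notin> infinitesimal"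
  shows "s \<in> rightward \<or> - s \<in> rightward"
proof (rule ccontr)
  assume neg: "\<not> ?thesis"
  have ms: "- s \<in> L" "- s \<notin> infinitesimal"
    using s act_minus_fixed[of "- s"] uminus_mem by (auto simp: infinitesimal_def)
  obtain x where x: "x \<in> unbounded_points" "\<rho> s x \<le> x"
    using neg s unfolding rightward_def by force
  obtain y where y: "y \<in> unbounded_points" "\<rho> (- s) y \<le> y"
    using neg ms unfolding rightward_def by force
  \<comment> \<open>Here the iterates of \<open>x\<close> under \<open>t\<close> stay below
    \<open>z\<close>. Whichever of the points \<open>x\<close> and \<open>y\<close> above is the
    smaller, this applies to \<open>s\<close> or to \<open>- s\<close>.\<close>
  have *: False if t: "t \<in> L" "t \<notin> infinitesimal" and x: "x \<in> unbounded_points" "x \<le> \<rho> t x"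
    and z: "x \<le> z" "\<rho> t z \<le> z" for t x z
  proof -
    have nat: "(\<rho> t ^^ n) x \<le> z" for n
    proof (induction n)
      case (Suc n)
      then have "\<rho> t ((\<rho> t ^^ n) x) \<le> \<rho> t z" using act_le_iff t by blast
      then show ?case using z by simp
    qed (use z in simp)
    then show False using infinitesimal_if_bounded[OF t(1) x, of z] t by (simp add: act_of_nat)
  qed
  have "x \<le> \<rho> (- s) x" using x act_le_iff[OF ms(1), of "\<rho> s x" x] s by simp
  moreover have "y \<le> \<rho> s y" using y act_le_iff[OF s(1), of "\<rho> (- s) y" y] s by simp
  ultimately show False
    using *[OF ms, of x y] *[OF s, of y x] x y by linarith
qed

lemma infinitesimal_add:
  assumes "s \<in> infinitesimal" "t \<in> infinitesimal"
  shows "s + t \<in> infinitesimal"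
proof -
  have "unbounded_points \<noteq> {}" using assms by (auto simp: infinitesimal_def)
  then obtain p where "p \<in> unbounded_points" "\<rho> s p = p" "\<rho> t p = p"
    using common_fixed_point[of "{s, t}"] assms by auto
  then show ?thesis using assms act_add[of s t p] add_mem by (auto simp: infinitesimal_def)
qed

lemma infinitesimal_of_int: "s \<in> infinitesimal \<Longrightarrow> of_int n * s \<in> infinitesimal"
  using act_of_int_fixed of_int_mult_mem by (fastforce simp: infinitesimal_def)

lemma infinitesimal_of_int_cancel:
  "\<lbrakk>s \<in> L; n \<noteq> 0; of_int n * s \<in> infinitesimal\<rbrakk> \<Longrightarrow> s \<in> infinitesimal"
  using act_of_int_mult_fixed by (fastforce simp: infinitesimal_def)

text \<open>Otherwise the finitely many elements of \<open>B\<close> have a common fixed point. It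
  is fixed by their integer combinations, hence by all of \<open>L\<close>, although its orbit is
  unbounded.\<close>

lemma ex_not_infinitesimal:
  assumes B: "finite B" "B \<subseteq> L" and ne: "unbounded_points \<noteq> {}"
    and span: "\<And>s. s \<in> L \<Longrightarrow> \<exists>n c. n \<noteq> 0 \<and> of_int n * s = (\<Sum>b\<in>B. of_int (c b) * b)"
  shows "\<exists>s\<in>L. s \<notin> infinitesimal"
proof (rule ccontr)
  assume "\<not> ?thesis"
  then have "B \<subseteq> infinitesimal" using B by blast
  then obtain p where p: "p \<in> unbounded_points" "\<forall>b\<in>B. \<rho> b p = p"
    using common_fixed_point B ne by blast
  have sum: "(\<Sum>b\<in>C. of_int (c b) * b) \<in> L \<and> \<rho> (\<Sum>b\<in>C. of_int (c b) * b) p = p"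
    if "C \<subseteq> B" for C c
    using finite_subset[OF that B(1)] that
  proof (induction C rule: finite_induct)
    case (insert b C)
    then have "b \<in> L" "\<rho> b p = p" using B p by auto
    then show ?case using insert act_of_int_fixed
      by (auto simp: act_add add_mem of_int_mult_mem)
  qed (auto simp: zero_mem act_zero)
  have "\<rho> s p = p" if s: "s \<in> L" for s
    using span[OF s] sum[of B] act_of_int_mult_fixed[OF s] by (metis order_refl)
  moreover obtain s where "s \<in> L" "p < \<rho> s p" using p(1) unfolding unbounded_points_def by blast
  ultimately show False by force
qed

lemma rightward_unbounded:
  assumes s: "s \<in> rightward" and x: "x \<in> unbounded_points"
  shows "\<exists>n. M < \<rho> (of_nat n * s) x"
proof (rule ccontr)
  assume "\<not> ?thesis"
  then have "\<rho> (of_nat n * s) x \<le> M" for n by (meson not_less)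
  moreover have "x \<le> \<rho> s x" "s \<in> L" using s x by (auto simp: rightward_def less_imp_le)
  ultimately have "s \<in> infinitesimal" using infinitesimal_if_bounded x by blast
  then show False using s by (force simp: rightward_def infinitesimal_def)
qed

text \<open>The map \<open>a\<close> normalizes the action and, being increasing and onto, preserves
  the upper end of the line. It carries unbounded orbits to unbounded orbits and fixed points to
  fixed points.\<close>

lemma
  assumes a: "strict_mono a" "surj a" and conj: "\<And>s x. s \<in> L \<Longrightarrow> a (\<rho> s x) = \<rho> (\<alpha> * s) (a x)"
    and stable: "\<And>s. s \<in> L \<Longrightarrow> \<alpha> * s \<in> L"
  shows unbounded_points_stable: "x \<in> unbounded_points \<Longrightarrow> a x \<in> unbounded_points"
    and infinitesimal_stable: "s \<in> infinitesimal \<Longrightarrow> \<alpha> * s \<in> infinitesimal"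
proof -
  show *: "a x \<in> unbounded_points" if x: "x \<in> unbounded_points" for x
    unfolding unbounded_points_def
  proof (rule CollectI, rule allI)
    fix M
    obtain m where m: "M = a m" using a(2) by auto
    obtain t where t: "t \<in> L" "m < \<rho> t x" using x unfolding unbounded_points_def by blast
    then have "M < \<rho> (\<alpha> * t) (a x)" using conj m a(1) by (metis strict_mono_less)
    then show "\<exists>s\<in>L. M < \<rho> s (a x)" using stable t by blast
  qed
  show "\<alpha> * s \<in> infinitesimal" if si: "s \<in> infinitesimal"
  proof -
    obtain x where x: "x \<in> unbounded_points" "\<rho> s x = x" and s: "s \<in> L"
      using si by (auto simp: infinitesimal_def)
    then have "\<rho> (\<alpha> * s) (a x) = a x" using conj[OF s, of x] by simp
    then show ?thesis using *[OF x(1)] stable[OF s] unfolding infinitesimal_def by blast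
  qed
qed

text \<open>Here points must be pulled back along \<open>a\<close>; the inverse multiplier \<beta>
  keeps the pulled-back group elements in \<open>L\<close>.\<close>

lemma rightward_stable:
  assumes a: "strict_mono a" "surj a" and conj: "\<And>s x. s \<in> L \<Longrightarrow> a (\<rho> s x) = \<rho> (\<alpha> * s) (a x)"
    and stable: "\<And>s. s \<in> L \<Longrightarrow> \<alpha> * s \<in> L" "\<And>s. s \<in> L \<Longrightarrow> \<beta> * s \<in> L" and inverse: "\<alpha> * \<beta> = 1"
    and s: "s \<in> rightward"
  shows "\<alpha> * s \<in> rightward"
proof -
  have sL: "s \<in> L" using s by (simp add: rightward_def)
  have "x < \<rho> (\<alpha> * s) x" if x: "x \<in> unbounded_points" for x
  proof -
    obtain y where y: "x = a y" using a(2) by auto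
    have "y \<in> unbounded_points"
      unfolding unbounded_points_def
    proof (rule CollectI, rule allI)
      fix M
      obtain t where t: "t \<in> L" "a M < \<rho> t x" using x unfolding unbounded_points_def by blast
      have "\<rho> t x = a (\<rho> (\<beta> * t) y)"
        using conj[OF stable(2)[OF t(1)], of y] inverse by (simp add: y mult.assoc[symmetric])
      then have "M < \<rho> (\<beta> * t) y" using t(2) a(1) by (simp add: strict_mono_less)
      then show "\<exists>s\<in>L. M < \<rho> s y" using stable(2)[OF t(1)] by blast
    qed
    then have "y < \<rho> s y" using s unfolding rightward_def by blast
    then show ?thesis using conj[OF sL, of y] a(1) y by (metis strict_mono_less)
  qed
  then show ?thesis using stable(1)[OF sL] unfolding rightward_def by blast
qed

text \<open>For large \<open>N\<close>, \<open>a\<close> carries the \<open>N\<close>-th fundamental interval of \<open>s\<close> beyond the next one.\<close>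
lemma eventually_moves_up:
  assumes s: "s \<in> rightward" "\<alpha> * s - s \<in> rightward" and ne: "unbounded_points \<noteq> {}"
    and a: "strict_mono a" "surj a" and conj: "\<And>s x. s \<in> L \<Longrightarrow> a (\<rho> s x) = \<rho> (\<alpha> * s) (a x)"
    and stable: "\<And>s. s \<in> L \<Longrightarrow> \<alpha> * s \<in> L"
  shows "\<forall>\<^sub>F x in at_top. x < a x"
proof -
  obtain x0 where x0: "x0 \<in> unbounded_points" using ne by blast
  have sL: "s \<in> L" "\<alpha> * s - s \<in> L" using s by (auto simp: rightward_def)
  \<comment> \<open>The points \<open>y n\<close> are the ends of the fundamental intervals of
    \<open>s\<close>.\<close>
  define y where "y n = \<rho> (of_nat n * s) x0" for n
  have y_Suc: "y (Suc n) = \<rho> (of_nat n * s) (\<rho> s x0)" for n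
    using act_add[of "of_nat n * s" s x0] by (simp add: y_def sL of_nat_mult_mem distrib_right add.commute)
  have mono_y: "y n < y (Suc n)" for n
    using x0 s act_less_iff[OF of_nat_mult_mem[OF sL(1)]] y_Suc[of n]
    by (auto simp: rightward_def y_def)
  have ax0: "a x0 \<in> unbounded_points"
    using unbounded_points_stable[OF a conj stable] x0 by blast
  obtain N where N: "\<rho> s x0 < \<rho> (of_nat N * (\<alpha> * s - s)) (a x0)"
    using rightward_unbounded[OF s(2) ax0] by blast
  have "x < a x" if "y N \<le> x" for x
  proof -
    obtain m where "x < y m" using rightward_unbounded[OF s(1) x0] y_def by metis
    \<comment> \<open>With \<open>n\<close> least, \<open>x\<close> lies in the interval from
      \<open>y (n - 1)\<close> to \<open>y n\<close>; the bound \<open>y N \<le> x\<close> forces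
      \<open>N \<le> n - 1\<close>.\<close>
    then obtain n where n: "x < y n" "\<And>i. i < n \<Longrightarrow> y i \<le> x"
      using exists_least_iff[of "\<lambda>n. x < y n"] by (meson not_less)
    have "y n \<le> y N" if "n \<le> N"
      using lift_Suc_mono_le[of y n N] mono_y that by (simp add: less_imp_le)
    then have "N < n" using n(1) that by fastforce
    then obtain k where k: "n = Suc k" "N \<le> k" by (metis less_Suc_eq_le less_imp_Suc_add le_add1)
    define z where "z k = \<rho> (of_nat k * (\<alpha> * s - s)) (a x0)" for k
    have "z k \<le> z (Suc k)" for k
    proof -
      have "z k \<in> unbounded_points"
        unfolding z_def by (intro unbounded_points_act ax0 of_nat_mult_mem sL)
      then have "z k < \<rho> (\<alpha> * s - s) (z k)" using s(2) unfolding rightward_def by blast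
      then show ?thesis by (simp add: z_def act_of_nat[OF sL(2)] del: of_nat_Suc)
    qed
    from lift_Suc_mono_le[of z, OF this k(2)]
    have up: "\<rho> (of_nat N * (\<alpha> * s - s)) (a x0) \<le> \<rho> (of_nat k * (\<alpha> * s - s)) (a x0)"
      by (simp only: z_def)
    \<comment> \<open>The chain compares \<open>y (k + 1)\<close> with \<open>a (y k)\<close>: the
      latter is \<open>k\<close> times \<open>\<alpha> * s\<close> applied to \<open>a x0\<close>,
      and that multiple splits into \<open>k\<close> times \<open>s\<close> and \<open>k\<close>
      times \<open>\<alpha> * s - s\<close>.\<close>
    have "x < y (Suc k)" using n k by simp
    also have "\<dots> = \<rho> (of_nat k * s) (\<rho> s x0)" by (rule y_Suc)
    also have "\<dots> < \<rho> (of_nat k * s) (\<rho> (of_nat k * (\<alpha> * s - s)) (a x0))"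
      using N up by (simp add: act_less_iff of_nat_mult_mem sL)
    also have "\<dots> = \<rho> (of_nat k * s + of_nat k * (\<alpha> * s - s)) (a x0)"
      by (simp add: act_add of_nat_mult_mem sL)
    also have "of_nat k * s + of_nat k * (\<alpha> * s - s) = \<alpha> * (of_nat k * s)"
      by (simp add: algebra_simps)
    also have "\<rho> (\<alpha> * (of_nat k * s)) (a x0) = a (y k)"
      unfolding y_def by (subst conj) (simp_all add: of_nat_mult_mem sL)
    also have "\<dots> \<le> a x" using n(2)[of k] k a(1) by (simp add: strict_mono_less_eq)
    finally show ?thesis .
  qed
  then show ?thesis unfolding eventually_at_top_linorder by blast
qed

text \<open>The root condition writes a nonzero integer \<open>c\<close> as a multiple of
  \<open>\<alpha> - 1\<close>, so \<open>c s\<close> is obtained from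
  \<open>\<alpha> * s - s\<close> by a polynomial in \<open>\<alpha> - 1\<close>. If the latter
  element were infinitesimal, so would be \<open>c s\<close> and then \<open>s\<close>.\<close>

lemma mult_not_infinitesimal:
  assumes s: "s \<in> L" "s \<notin> infinitesimal" and p: "Polynomial.coeff p 0 \<noteq> 0"
    and root: "poly (map_poly of_int p) (\<alpha> - 1) = 0"
    and inf: "\<And>t. t \<in> infinitesimal \<Longrightarrow> \<alpha> * t \<in> infinitesimal"
  shows "\<alpha> * s - s \<notin> infinitesimal"
proof
  assume I: "\<alpha> * s - s \<in> infinitesimal"
  have closed: "(\<alpha> - 1) * t \<in> infinitesimal" if "t \<in> infinitesimal" for t
    using infinitesimal_add[OF inf[OF that] infinitesimal_of_int[OF that, of "-1"]]
    by (simp add: algebra_simps)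
  have zero: "0 \<in> infinitesimal" using infinitesimal_of_int[OF I, of 0] by simp
  have poly: "poly (map_poly of_int q) (\<alpha> - 1) * t \<in> infinitesimal" if "t \<in> infinitesimal" for q t
  proof (induction q)
    case (pCons c q)
    have "poly (map_poly of_int (pCons c q)) (\<alpha> - 1) * t =
        of_int c * t + (\<alpha> - 1) * (poly (map_poly of_int q) (\<alpha> - 1) * t)"
      using pCons.hyps by (simp add: map_poly_pCons algebra_simps)
    then show ?case using infinitesimal_add infinitesimal_of_int that closed pCons by metis
  qed (simp add: zero)
  obtain c q where cq: "p = pCons c q" by (cases p)
  have "of_int c + (\<alpha> - 1) * poly (map_poly of_int q) (\<alpha> - 1) = 0"
    using root p by (simp add: cq map_poly_pCons)
  then have "(of_int c + (\<alpha> - 1) * poly (map_poly of_int q) (\<alpha> - 1)) * s = 0" by simp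
  then have "of_int c * s = - (poly (map_poly of_int q) (\<alpha> - 1) * (\<alpha> * s - s))"
    by (simp only: eq_neg_iff_add_eq_0) (simp add: algebra_simps)
  moreover have "- (poly (map_poly of_int q) (\<alpha> - 1) * (\<alpha> * s - s)) \<in> infinitesimal"
    using infinitesimal_of_int[OF poly[OF I, of q], of "-1"] by simp
  ultimately show False
    using infinitesimal_of_int_cancel[OF s(1), of c] s p cq by simp
qed

end

section \<open>Finite-index subgroups of SL(2) over the integers of a number field\<close>

locale arithmetic_subgroup = complex_number_field +
  fixes \<Gamma> :: "complex mat set"
  assumes finite_index: "finite_index_subgroup \<Gamma> (SL 2 (ring_of_integers F))"
begin

lemma group_SL: "group (SL 2 \<O>)"
  by (rule group_SL2) (simp_all add: integers_closed)

lemma subgroup_SL: "subgroup \<Gamma> (SL 2 \<O>)"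
  using finite_index by (simp add: finite_index_subgroup_def)

lemma SL_carrier_mat: "A \<in> carrier (SL 2 R) \<Longrightarrow> A \<in> carrier_mat 2 2"
  by (simp add: SL_def)

lemma Gamma_SL: "A \<in> \<Gamma> \<Longrightarrow> A \<in> carrier (SL 2 \<O>)"
  using subgroup.subset[OF subgroup_SL] by blast

lemma Gamma_carrier_mat: "A \<in> \<Gamma> \<Longrightarrow> A \<in> carrier_mat 2 2"
  by (rule SL_carrier_mat[OF Gamma_SL])

lemma Gamma_one: "1\<^sub>m 2 \<in> \<Gamma>"
  using subgroup.one_closed[OF subgroup_SL] by simp

lemma Gamma_mult: "\<lbrakk>A \<in> \<Gamma>; B \<in> \<Gamma>\<rbrakk> \<Longrightarrow> A * B \<in> \<Gamma>"
  using subgroup.m_closed[OF subgroup_SL] by simp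

lemma Gamma_inverse:
  assumes "A \<in> \<Gamma>"
  obtains B where "B \<in> \<Gamma>" "A * B = 1\<^sub>m 2" "B * A = 1\<^sub>m 2"
  using that[OF subgroup.m_inv_closed[OF subgroup_SL assms]]
    group.r_inv[OF group_SL Gamma_SL[OF assms]] group.l_inv[OF group_SL Gamma_SL[OF assms]] by simp

text \<open>Pigeonhole over the finitely many cosets. Quotients of two members of \<open>S'\<close>
  lie in \<Gamma>, which is how elements of \<Gamma> are produced below.\<close>

lemma infinite_same_coset:
  assumes S: "infinite S" "S \<subseteq> carrier (SL 2 \<O>)"
  obtains S' where "infinite S'" "S' \<subseteq> S" "\<forall>A\<in>S'. \<forall>B\<in>S'. \<exists>C\<in>\<Gamma>. A = C * B"
proof -
  let ?f = "\<lambda>A. \<Gamma> #>\<^bsub>SL 2 \<O>\<^esub> A"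
  have "?f ` S \<subseteq> rcosets\<^bsub>SL 2 \<O>\<^esub> \<Gamma>" using S(2) by (auto simp: RCOSETS_def)
  moreover have "finite (rcosets\<^bsub>SL 2 \<O>\<^esub> \<Gamma>)" using finite_index by (simp add: finite_index_subgroup_def)
  ultimately have "finite (?f ` S)" by (rule finite_subset)
  then obtain B0 where B0: "infinite {A \<in> S. ?f A = ?f B0}" using pigeonhole_infinite[OF S(1)] by blast
  have *: "\<exists>C\<in>\<Gamma>. A = C * B" if "A \<in> {A \<in> S. ?f A = ?f B0}" "B \<in> {A \<in> S. ?f A = ?f B0}" for A B
  proof -
    have "A \<in> carrier_mat 2 2" using that S(2) SL_carrier_mat by blast
    then have "A \<in> ?f A" using Gamma_one unfolding r_coset_def by force
    also have "?f A = ?f B" using that by simp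
    finally show ?thesis by (auto simp: r_coset_def)
  qed
  show ?thesis by (rule that[OF B0]) (blast, intro ballI *)
qed

lemma transv_in_SL:
  assumes "fst v \<in> \<O>" "snd v \<in> \<O>" "s \<in> \<O>"
  shows "transv v s \<in> carrier (SL 2 \<O>)"
proof -
  have "(1 - s * fst v * snd v) * (1 + s * fst v * snd v) - s * (fst v)\<^sup>2 * (- s * (snd v)\<^sup>2) = 1"
    by (simp add: power2_eq_square algebra_simps)
  then show ?thesis
    using assms by (simp add: transv_def integers_closed power2_eq_square del: mult_minus_left)
qed

text \<open>Two of the infinitely many integer multiples fall into the same coset; their difference
  is the required multiple.\<close>

lemma multiple_transv_in_Gamma:
  assumes v: "fst v \<in> \<O>" "snd v \<in> \<O>" "v \<noteq> (0, 0)" and s: "s \<in> \<O>"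
  obtains n :: int where "n \<noteq> 0" "transv v (of_int n * s) \<in> \<Gamma>"
proof (cases "s = 0")
  case True
  then show ?thesis using that[of 1] Gamma_one by simp
next
  case False
  let ?f = "\<lambda>n :: int. transv v (of_int n * s)"
  have "inj ?f" using False by (auto simp: inj_on_def transv_inject[OF v(3)])
  then have infS: "infinite (range ?f)" by (simp add: finite_image_iff)
  have subS: "range ?f \<subseteq> carrier (SL 2 \<O>)"
    using transv_in_SL[OF v(1,2)] integers_closed(4)[OF integers_of_int s] by blast
  obtain S where S: "infinite S" "S \<subseteq> range ?f" "\<forall>A\<in>S. \<forall>B\<in>S. \<exists>C\<in>\<Gamma>. A = C * B"
    using infinite_same_coset[OF infS subS] .
  obtain A where A: "A \<in> S" using S(1) by (metis ex_in_conv finite.emptyI)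
  obtain B where B: "B \<in> S" "B \<noteq> A"
    using S(1) by (metis finite.emptyI finite_insert finite_subset singletonI subsetI insertCI)
  obtain C where C: "C \<in> \<Gamma>" "A = C * B" using S(3) A B(1) by blast
  obtain m n where mn: "A = ?f m" "B = ?f n" using A B S(2) by blast
  have "C = C * (?f n * ?f (- n))"
    using Gamma_carrier_mat[OF C(1)] by (simp add: transv_add[symmetric])
  also have "\<dots> = A * ?f (- n)"
    unfolding C(2) mn(2) using Gamma_carrier_mat[OF C(1)] by (simp add: assoc_mult_mat[of _ 2 2 _ 2 _ 2])
  also have "\<dots> = ?f (m - n)" unfolding mn(1) transv_add[symmetric] by (simp add: algebra_simps)
  finally have "?f (m - n) \<in> \<Gamma>" using C(1) by simp
  moreover have "m - n \<noteq> 0" using B(2) mn by auto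
  ultimately show ?thesis using that by blast
qed

text \<open>Units congruent to 1 modulo \<open>wedge v u\<close> give infinitely many integral
  matrices that are diagonal in the basis \<open>v\<close>, \<open>u\<close>. The quotient of two in
  one coset lies in \<Gamma> and has the quotients of the eigenvalues as its own.\<close>

lemma diagonal_in_Gamma:
  assumes inf: "infinite unit_set"
    and v: "fst v \<in> \<O>" "snd v \<in> \<O>" and u: "fst u \<in> \<O>" "snd u \<in> \<O>" and d: "wedge v u \<noteq> 0"
  obtains A w where "A \<in> \<Gamma>" "w \<in> unit_set" "w\<^sup>2 \<noteq> 1" "mv2 A v = scale2 w v" "mv2 A u = scale2 (inverse w) u"
proof -
  have v0: "v \<noteq> (0, 0)" and u0: "u \<noteq> (0, 0)" using d by (auto simp: wedge_def)
  define W where "W = {w \<in> unit_set. \<exists>y\<in>\<O>. \<exists>z\<in>\<O>. w = 1 + wedge v u * y \<and> inverse w = 1 + wedge v u * z}"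
  have dO: "wedge v u \<in> \<O>" using v u by (simp add: wedge_def integers_closed)
  have W: "infinite W" unfolding W_def by (rule infinite_congruent_units[OF inf dO d])
  have nz: "w \<noteq> 0" if "w \<in> W" for w using that by (auto simp: W_def unit_set_def)
  have "\<exists>A\<in>carrier (SL 2 \<O>). mv2 A v = scale2 w v \<and> mv2 A u = scale2 (inverse w) u" if w: "w \<in> W" for w
  proof -
    from w obtain y z where yz: "y \<in> \<O>" "z \<in> \<O>" "w = 1 + wedge v u * y" "inverse w = 1 + wedge v u * z"
      unfolding W_def by blast
    show ?thesis
      by (rule diagonal_in_SL2[OF _ _ _ _ v u d _ yz(3,4,1,2)]) (use nz[OF w] integers_closed in simp_all)
  qed
  then obtain f where f: "\<And>w. w \<in> W \<Longrightarrow> f w \<in> carrier (SL 2 \<O>)"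
    "\<And>w. w \<in> W \<Longrightarrow> mv2 (f w) v = scale2 w v" "\<And>w. w \<in> W \<Longrightarrow> mv2 (f w) u = scale2 (inverse w) u"
    by metis
  have inj: "inj_on f W" by (rule inj_onI) (metis f(2) scale2_right_cancel[OF v0])
  then have infS: "infinite (f ` W)" using W by (simp add: finite_image_iff)
  have subS: "f ` W \<subseteq> carrier (SL 2 \<O>)" using f(1) by blast
  obtain S where S: "infinite S" "S \<subseteq> f ` W" "\<forall>A\<in>S. \<forall>B\<in>S. \<exists>C\<in>\<Gamma>. A = C * B"
    using infinite_same_coset[OF infS subS] .
  obtain B where B: "B \<in> S" using S(1) by (metis ex_in_conv finite.emptyI)
  obtain t where t: "t \<in> W" "B = f t" using B S(2) by blast
  \<comment> \<open>Leaving out the matrices of \<open>t\<close> and \<open>- t\<close> keeps the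
    square of the eigenvalue quotient away from 1.\<close>
  have "infinite (S - f ` (W \<inter> {t, - t}))" using S(1) by simp
  then obtain A where A: "A \<in> S" "A \<notin> f ` (W \<inter> {t, - t})" by (metis DiffE ex_in_conv finite.emptyI)
  obtain w where w: "w \<in> W" "A = f w" using A(1) S(2) by blast
  have wt: "w \<noteq> t" "w \<noteq> - t" using A(2) w by auto
  obtain C where C: "C \<in> \<Gamma>" "A = C * B" using S(3) A(1) B by blast
  have mvC: "mv2 A x = mv2 C (mv2 B x)" for x
    unfolding C(2) using Gamma_carrier_mat[OF C(1)] SL_carrier_mat[OF f(1)[OF t(1)]] t(2)
    by (simp add: mv2_mult)
  have "scale2 w v = scale2 t (mv2 C v)" using mvC[of v] f(2)[OF w(1)] f(2)[OF t(1)] w(2) t(2) by (simp add: mv2_scale2)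
  then have "scale2 (inverse t) (scale2 w v) = scale2 (inverse t) (scale2 t (mv2 C v))" by simp
  then have 1: "mv2 C v = scale2 (w * inverse t) v" using nz[OF t(1)] by (simp add: mult.commute)
  have "scale2 (inverse w) u = scale2 (inverse t) (mv2 C u)"
    using mvC[of u] f(3)[OF w(1)] f(3)[OF t(1)] w(2) t(2) by (simp add: mv2_scale2)
  then have "scale2 t (scale2 (inverse w) u) = scale2 t (scale2 (inverse t) (mv2 C u))" by simp
  then have 2: "mv2 C u = scale2 (inverse (w * inverse t)) u" using nz[OF t(1)] by (simp add: mult.commute)
  have "w * inverse t \<in> unit_set"
    using w(1) t(1) by (auto simp: W_def unit_set_def integers_closed)
  moreover have "(w * inverse t)\<^sup>2 \<noteq> 1"
  proof
    assume "(w * inverse t)\<^sup>2 = 1"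
    then have "w * inverse t = 1 \<or> w * inverse t = - 1" by (simp add: power2_eq_1_iff)
    then show False using wt nz[OF t(1)] by (auto simp: field_simps)
  qed
  ultimately show ?thesis using that C(1) 1 2 by blast
qed

text \<open>A nontrivial transvection along a vector \<open>e\<close> not parallel to
  \<open>v\<close> moves the line of \<open>v\<close>. A standard basis vector serves as
  \<open>e\<close>.\<close>

lemma ex_transverse:
  assumes v: "fst v \<in> \<O>" "snd v \<in> \<O>" "v \<noteq> (0, 0)"
  obtains C where "C \<in> \<Gamma>" "wedge v (mv2 C v) \<noteq> 0"
proof -
  obtain e :: "complex \<times> complex" where e: "fst e \<in> \<O>" "snd e \<in> \<O>" "e \<noteq> (0, 0)" "wedge v e \<noteq> 0"
  proof (cases "snd v = 0")
    case True
    then show ?thesis using that[of "(0, 1)"] v by (cases v) (auto simp: wedge_def integers_closed)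
  next
    case False
    then show ?thesis using that[of "(1, 0)"] v by (auto simp: wedge_def integers_closed)
  qed
  obtain n :: int where n: "n \<noteq> 0" "transv e (of_int n * 1) \<in> \<Gamma>"
    using multiple_transv_in_Gamma[OF e(1-3) integers_closed(2)] .
  have "wedge v (mv2 (transv e (of_int n)) v) = - of_int n * (wedge v e)\<^sup>2"
    by (simp add: transv_def wedge_def power2_eq_square algebra_simps)
  then show ?thesis using that[OF n(2)] n(1) e(4) by simp
qed

lemma unit_power2_minus_one_poly:
  assumes "w \<in> unit_set" "w\<^sup>2 \<noteq> 1"
  obtains p :: "int poly" where "Polynomial.coeff p 0 \<noteq> 0" "poly (map_poly of_int p) (w\<^sup>2 - 1) = 0"
proof -
  have "w\<^sup>2 - 1 \<in> \<O>" using assms(1) by (simp add: unit_set_def power2_eq_square integers_closed)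
  then show ?thesis
    using algebraic_int_nonzero_poly[of "w\<^sup>2 - 1"] that assms(2) integers_algebraic by auto
qed

text \<open>Stated for any increasing action \<open>\<psi>\<close>, so that it applies to an action
  on the line and to its reflection.\<close>

lemma transv_orbit_bdd_above:
  assumes inf: "infinite unit_set"
    and mono: "\<And>A. A \<in> \<Gamma> \<Longrightarrow> strict_mono (\<psi> A)"
    and mult: "\<And>A B x. \<lbrakk>A \<in> \<Gamma>; B \<in> \<Gamma>\<rbrakk> \<Longrightarrow> \<psi> (A * B) x = \<psi> A (\<psi> B x :: real)"
    and one: "\<And>x. \<psi> (1\<^sub>m 2) x = x"
    and v: "fst v \<in> \<O>" "snd v \<in> \<O>" "v \<noteq> (0, 0)"
  shows "\<exists>M. \<forall>s\<in>F. transv v s \<in> \<Gamma> \<longrightarrow> \<psi> (transv v s) x \<le> M"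
proof (rule ccontr)
  assume unbounded: "\<not> ?thesis"
  \<comment> \<open>Parameters are confined to \<open>F\<close>, which makes \<open>L\<close> a
    group of finite rank.\<close>
  define L where "L = {s \<in> F. transv v s \<in> \<Gamma>}"
  define \<rho> where "\<rho> s = \<psi> (transv v s)" for s
  have L: "s \<in> F" "transv v s \<in> \<Gamma>" if "s \<in> L" for s using that by (auto simp: L_def)
  have zeroL: "0 \<in> L" using Gamma_one by (simp add: L_def field_closed)
  have addL: "s + t \<in> L" if "s \<in> L" "t \<in> L" for s t
    using that by (simp add: L_def field_closed transv_add Gamma_mult)
  have uminusL: "- s \<in> L" if s: "s \<in> L" for s
  proof -
    obtain B where B: "B \<in> \<Gamma>" "B * transv v s = 1\<^sub>m 2" using Gamma_inverse[OF L(2)[OF s]] by metis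
    have "B = B * (transv v s * transv v (- s))"
      using Gamma_carrier_mat[OF B(1)] by (simp add: transv_add[symmetric])
    also have "\<dots> = transv v (- s)"
      using B Gamma_carrier_mat[OF B(1)]
      by (simp add: assoc_mult_mat[of _ 2 2 _ 2 _ 2, symmetric] left_mult_one_mat[of _ 2 2])
    finally show ?thesis using B(1) L(1)[OF s] by (simp add: L_def field_closed)
  qed
  interpret additive_line_action L \<rho>
    by unfold_locales
      (simp_all add: zeroL addL uminusL \<rho>_def L mono transv_add mult one)
  have "x \<in> unbounded_points"
    unfolding unbounded_points_def using unbounded by (auto simp: not_le \<rho>_def L_def)
  then have ne: "unbounded_points \<noteq> {}" by blast
  have surj: "surj (\<psi> A)" if A: "A \<in> \<Gamma>" for A
  proof -
    obtain B where B: "B \<in> \<Gamma>" "A * B = 1\<^sub>m 2" using Gamma_inverse[OF A] by metis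
    then have "\<psi> A (\<psi> B x) = x" for x using mult[OF A B(1), of x] one by simp
    then show ?thesis by (metis surjI)
  qed
  have conj: "\<psi> A (\<rho> s x) = \<rho> (w\<^sup>2 * s) (\<psi> A x) \<and> w\<^sup>2 * s \<in> L"
    if A: "A \<in> \<Gamma>" "mv2 A v = scale2 w v" "w \<in> unit_set" and s: "s \<in> L" for A w s x
  proof -
    have com: "A * transv v s = transv v (w\<^sup>2 * s) * A"
      using transv_conj[OF Gamma_SL[OF A(1)], of v s] by (simp add: A(2) transv_scale2)
    obtain B where B: "B \<in> \<Gamma>" "A * B = 1\<^sub>m 2" using Gamma_inverse[OF A(1)] by metis
    have "transv v (w\<^sup>2 * s) = transv v (w\<^sup>2 * s) * (A * B)"
      using B(2) by (simp add: right_mult_one_mat[of _ 2 2])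
    also have "\<dots> = A * transv v s * B"
      unfolding com using Gamma_carrier_mat A(1) B(1) by (simp add: assoc_mult_mat[of _ 2 2 _ 2 _ 2])
    finally have "transv v (w\<^sup>2 * s) \<in> \<Gamma>" using Gamma_mult A(1) B(1) L(2)[OF s] by simp
    moreover have "w\<^sup>2 * s \<in> F"
      using A(3) L(1)[OF s] integers_field by (simp add: unit_set_def field_closed power2_eq_square)
    ultimately have mem: "w\<^sup>2 * s \<in> L" by (simp add: L_def)
    then show ?thesis
      using mult[OF A(1) L(2)[OF s], of x] mult[OF L(2)[OF mem] A(1), of x] com by (simp add: \<rho>_def)
  qed
  \<comment> \<open>Each vector of a spanning set of \<open>F\<close> is scaled twice: by
    \<open>n\<close> into the integers and by \<open>m\<close> so that its transvection lies in
    \<Gamma>. The results span \<open>F\<close> and lie in \<open>L\<close>.\<close>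
  obtain s where s: "s \<in> L" "s \<notin> infinitesimal"
  proof -
    obtain B where B: "finite B" "B \<subseteq> F" "F \<subseteq> rat_vs.span B" using number_field_span[OF number_field] .
    have "\<exists>k :: int. k \<noteq> 0 \<and> of_int k * b \<in> L" if b: "b \<in> B" for b
    proof -
      obtain n :: int where n: "n > 0" "of_int n * b \<in> \<O>" using integer_multiple B(2) b by blast
      obtain m :: int where m: "m \<noteq> 0" "transv v (of_int m * (of_int n * b)) \<in> \<Gamma>"
        using multiple_transv_in_Gamma[OF v n(2)] .
      have "of_int (m * n) * b \<in> F" using B(2) b by (simp only: field_closed of_int_field subsetD)
      then show ?thesis using n m by (intro exI[of _ "m * n"]) (simp add: L_def mult.assoc)
    qed
    then obtain k :: "complex \<Rightarrow> int" where k: "\<And>b. b \<in> B \<Longrightarrow> k b \<noteq> 0 \<and> of_int (k b) * b \<in> L" by metis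
    define B' where "B' = (\<lambda>b. of_int (k b) * b) ` B"
    have B': "finite B'" "B' \<subseteq> L" using B(1) k by (auto simp: B'_def)
    have "B \<subseteq> rat_vs.span B'"
    proof
      fix b assume b: "b \<in> B"
      have "of_rat (1 / of_int (k b)) * (of_int (k b) * b) \<in> rat_vs.span B'"
        by (intro rat_vs.span_scale rat_vs.span_base) (simp add: B'_def b)
      then show "b \<in> rat_vs.span B'" using k[OF b] by (simp add: of_rat_divide)
    qed
    then have "rat_vs.span B \<subseteq> rat_vs.span B'" by (simp add: rat_vs.span_minimal)
    then have span: "\<exists>n c. n \<noteq> 0 \<and> of_int n * t = (\<Sum>b\<in>B'. of_int (c b) * b)" if "t \<in> L" for t
      using span_common_denominator[OF B'(1), of t] B(3) L(1)[OF that] by (metis less_irrefl subsetD)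
    show ?thesis using ex_not_infinitesimal[OF B' ne span] that by blast
  qed
  define t where "t = (if s \<in> rightward then s else - s)"
  have t: "t \<in> rightward" using not_infinitesimal_cases[OF s] by (auto simp: t_def)
  have tL: "t \<in> L" "t \<notin> infinitesimal" using t by (auto simp: rightward_def infinitesimal_def)
  obtain C where C: "C \<in> \<Gamma>" "wedge v (mv2 C v) \<noteq> 0" using ex_transverse[OF v] .
  define u where "u = mv2 C v"
  obtain p q r s where "C = mat2 p q r s" "p \<in> \<O>" "q \<in> \<O>" "r \<in> \<O>" "s \<in> \<O>"
    using Gamma_SL[OF C(1)] by (auto simp: carrier_SL2)
  then have u: "fst u \<in> \<O>" "snd u \<in> \<O>" using v by (simp_all add: u_def integers_closed)
  obtain A w where A: "A \<in> \<Gamma>" "w \<in> unit_set" "w\<^sup>2 \<noteq> 1" "mv2 A v = scale2 w v" "mv2 A u = scale2 (inverse w) u"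
    using diagonal_in_Gamma[OF inf v(1,2) u C(2)[folded u_def]] .
  obtain A' where A': "A' \<in> \<Gamma>" "A * A' = 1\<^sub>m 2" "A' * A = 1\<^sub>m 2" using Gamma_inverse[OF A(1)] .
  obtain C' where C': "C' \<in> \<Gamma>" "C * C' = 1\<^sub>m 2" "C' * C = 1\<^sub>m 2" using Gamma_inverse[OF C(1)] .
  have w0: "w \<noteq> 0" using A(2) by (simp add: unit_set_def)
  have w': "inverse w \<in> unit_set" using A(2) by (simp add: unit_set_def)
  have inv_eigen: "mv2 H x = scale2 (inverse c) x"
    if "G \<in> \<Gamma>" "H \<in> \<Gamma>" "H * G = 1\<^sub>m 2" "mv2 G x = scale2 c x" "c \<noteq> 0" for G H c x
  proof -
    have "mv2 (H * G) x = mv2 H (mv2 G x)" by (rule mv2_mult[OF that(2,1)[THEN Gamma_carrier_mat]])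
    then have "mv2 H (mv2 G x) = x" using that(3) by simp
    then have "scale2 (inverse c) (scale2 c (mv2 H x)) = scale2 (inverse c) x"
      using that by (simp add: mv2_scale2)
    then show ?thesis using that(5) by simp
  qed
  \<comment> \<open>Stated for a pair of inverse elements \<open>G\<close> and \<open>H\<close>,
    because it is needed for \<open>A\<close> and its inverse in either order.\<close>
  have contra: False
    if G: "G \<in> \<Gamma>" "H \<in> \<Gamma>" "H * G = 1\<^sub>m 2" "mv2 G v = scale2 c v" "mv2 H u = scale2 c u" "c \<in> unit_set"
      and pos: "c\<^sup>2 * t - t \<in> rightward" for G H c
  proof -
    have cC: "C \<in> carrier_mat 2 2" "C' \<in> carrier_mat 2 2" "H \<in> carrier_mat 2 2"
      using Gamma_carrier_mat C C' G by auto
    have K: "C' * (H * C) \<in> \<Gamma>" using Gamma_mult C(1) C'(1) G(2) by simp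
    \<comment> \<open>Since \<open>u = C v\<close>, conjugating \<open>H\<close> by \<open>C\<close>
      turns its eigenvector \<open>u\<close> into \<open>v\<close>.\<close>
    have "mv2 (C' * (H * C)) v = mv2 C' (mv2 H u)" using cC by (simp add: mv2_mult u_def)
    also have "\<dots> = scale2 c (mv2 (C' * C) v)" using cC by (simp add: G(5)[unfolded u_def] mv2_scale2 u_def mv2_mult)
    finally have Kv: "mv2 (C' * (H * C)) v = scale2 c v" by (simp add: C'(3))
    have up: "\<forall>\<^sub>F x in at_top. x < \<psi> D x" if D: "D \<in> \<Gamma>" "mv2 D v = scale2 c v" for D
      by (rule eventually_moves_up[OF t pos ne mono[OF D(1)] surj[OF D(1)]]) (use conj[OF D G(6)] in blast)+
    obtain m where m: "\<And>x. x \<ge> m \<Longrightarrow> x < \<psi> G x"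
      using up[OF G(1,4)] unfolding eventually_at_top_linorder by blast
    obtain n where n: "\<And>x. x \<ge> n \<Longrightarrow> x < \<psi> (C' * (H * C)) x"
      using up[OF K Kv] unfolding eventually_at_top_linorder by blast
    obtain z where z: "\<psi> C z = m" using surj[OF C(1)] by (metis surjD)
    \<comment> \<open>So large that both \<open>G\<close> at \<open>C y\<close> and the conjugate of
      \<open>H\<close> at \<open>y\<close> move the point to the right.\<close>
    define y where "y = max n z"
    have "m \<le> \<psi> C y" using z mono[OF C(1)] by (metis y_def max.cobounded2 strict_mono_less_eq)
    have "y < \<psi> C' (\<psi> H (\<psi> C y))" using n[of y] mult C(1) C'(1) G(2) Gamma_mult by (simp add: y_def)
    then have "\<psi> C y < \<psi> C (\<psi> C' (\<psi> H (\<psi> C y)))" using mono[OF C(1)] by (simp add: strict_mono_less)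
    also have "\<dots> = \<psi> H (\<psi> C y)" using mult[OF C(1) C'(1)] C'(2) one by metis
    finally have "\<psi> C y < \<psi> H (\<psi> C y)" .
    also have "\<dots> < \<psi> H (\<psi> G (\<psi> C y))"
      using m[OF \<open>m \<le> \<psi> C y\<close>] mono[OF G(2)] by (simp add: strict_mono_less)
    also have "\<dots> = \<psi> C y" using mult[OF G(2,1)] G(3) one by metis
    finally show False by simp
  qed
  obtain P :: "int poly" where P: "Polynomial.coeff P 0 \<noteq> 0" "poly (map_poly of_int P) (w\<^sup>2 - 1) = 0"
    using unit_power2_minus_one_poly[OF A(2,3)] .
  have "w\<^sup>2 * t - t \<notin> infinitesimal"
  proof (rule mult_not_infinitesimal[OF tL P])
    show "w\<^sup>2 * i \<in> infinitesimal" if "i \<in> infinitesimal" for i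
      by (rule infinitesimal_stable[OF mono[OF A(1)] surj[OF A(1)] _ _ that])
        (use conj[OF A(1,4,2)] in blast)+
  qed
  moreover have "w\<^sup>2 * t - t \<in> L" using conj[OF A(1,4,2) tL(1)] tL(1) by (simp add: diff_mem)
  ultimately consider "w\<^sup>2 * t - t \<in> rightward" | "- (w\<^sup>2 * t - t) \<in> rightward"
    using not_infinitesimal_cases by blast
  then show False
  proof cases
    case 1
    have "mv2 A' u = scale2 w u" using inv_eigen[OF A(1) A'(1,3) A(5)] w0 by simp
    then show False using contra[OF A(1) A'(1,3) A(4) _ A(2) 1] by blast
  next
    case 2
    have A'v: "mv2 A' v = scale2 (inverse w) v" by (rule inv_eigen[OF A(1) A'(1,3) A(4) w0])
    \<comment> \<open>Conjugation by the inverse of \<open>A\<close> turns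
      \<open>t - w\<^sup>2 t\<close> into \<open>w\<^sup>-\<^sup>2 t - t\<close>, the element needed
      for the eigenvalue \<open>inverse w\<close>.\<close>
    have "(inverse w)\<^sup>2 * - (w\<^sup>2 * t - t) \<in> rightward"
      by (rule rightward_stable[OF mono[OF A'(1)] surj[OF A'(1)], where \<beta> = "w\<^sup>2"])
        (use conj[OF A'(1) A'v w'] conj[OF A(1,4,2)] 2 w0 in \<open>auto simp: field_simps\<close>)
    also have "(inverse w)\<^sup>2 * - (w\<^sup>2 * t - t) = (inverse w)\<^sup>2 * t - t"
      using w0 by (simp add: field_simps power2_eq_square)
    finally show False using contra[OF A'(1) A(1) A'(2) A'v A(5) w'] by blast
  qed
qed

end

section \<open>Unipotent subgroups and bounded orbits\<close>

text \<open>An upper unitriangular matrix is a transvection along the first basis vector. Undoing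
  the conjugation by \<open>g\<close> carries that vector to \<open>v\<close>.\<close>

lemma unipotent_common_vector:
  assumes "unipotent_subgroup 2 U"
  obtains v where "v \<noteq> (0, 0)" "\<And>A. A \<in> U \<Longrightarrow> \<exists>t. A = transv v t"
proof -
  have grp: "group (SL 2 (UNIV :: complex set))" by (rule group_SL2) simp_all
  from assms obtain g where U: "subgroup U (SL 2 UNIV)" and g: "g \<in> carrier (SL 2 (UNIV :: complex set))"
    and sub: "subgroup ((\<lambda>u. g \<otimes>\<^bsub>SL 2 UNIV\<^esub> u \<otimes>\<^bsub>SL 2 UNIV\<^esub> inv\<^bsub>SL 2 UNIV\<^esub> g) ` U) (upper_unitriangular_group 2)"
    unfolding unipotent_subgroup_def by blast
  define h where "h = inv\<^bsub>SL 2 UNIV\<^esub> g"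
  have h: "h \<in> carrier (SL 2 UNIV)" "h * g = 1\<^sub>m 2" "g * h = 1\<^sub>m 2"
    using group.inv_closed[OF grp g] group.l_inv[OF grp g] group.r_inv[OF grp g] by (simp_all add: h_def)
  have carr: "A \<in> carrier_mat 2 2" if "A \<in> carrier (SL 2 UNIV)" for A :: "complex mat"
    using that by (simp add: SL_def)
  note gh = carr[OF g] carr[OF h(1)]
  define v where "v = mv2 h (1, 0)"
  have "mv2 g v = (1, 0)" using gh h(3) by (simp add: v_def mv2_mult[symmetric])
  then have "v \<noteq> (0, 0)" by (auto simp: mv2_def)
  moreover have "\<exists>t. A = transv v t" if A: "A \<in> U" for A
  proof -
    have A2: "A \<in> carrier_mat 2 2" using subgroup.mem_carrier[OF U A] by (rule carr)
    have "g * A * h \<in> carrier (upper_unitriangular_group 2)"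
      using subgroup.subset[OF sub] A by (auto simp: h_def)
    then have ut: "upper_triangular (g * A * h)" and *: "g * A * h \<in> carrier_mat 2 2"
      "(g * A * h) $$ (0, 0) = 1" "(g * A * h) $$ (1, 1) = 1"
      by (auto simp: upper_unitriangular_group_def)
    have "(g * A * h) $$ (1, 0) = 0" using upper_triangularD[OF ut, of 0 1] gh(1) by simp
    note * = * this
    define t where "t = (g * A * h) $$ (0, 1)"
    have "g * A * h = mat2 1 t 0 1" using eq_mat2[OF *(1)] *(2-4) by (simp add: t_def)
    also have "\<dots> = transv (1, 0) t" by (simp add: transv_def)
    finally have gAh: "g * A * h = transv (1, 0) t" .
    have "A = (h * g) * A * (h * g)"
      using A2 by (simp add: h(2) left_mult_one_mat[of _ 2 2] right_mult_one_mat[of _ 2 2])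
    also have "\<dots> = h * (g * A * h) * g"
      using gh A2 by (simp add: assoc_mult_mat[of _ 2 2 _ 2 _ 2])
    also have "\<dots> = transv v t * (h * g)"
      using gh transv_conj[OF h(1), of "(1, 0)" t]
      by (simp add: gAh v_def assoc_mult_mat[of _ 2 2 _ 2 _ 2])
    also have "\<dots> = transv v t" by (simp add: h(2) right_mult_one_mat[of _ 2 2])
    finally show ?thesis by blast
  qed
  ultimately show ?thesis by (rule that)
qed

text \<open>The common vector is only complex at first. The entries of one nontrivial element of
  \<open>U\<close> determine its line and supply an integral vector on it.\<close>

lemma (in complex_number_field) unipotent_common_integral_vector:
  assumes unip: "unipotent_subgroup 2 U" and sub: "U \<subseteq> carrier (SL 2 \<O>)" and nontriv: "\<not> U \<subseteq> {1\<^sub>m 2}"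
  obtains v where "fst v \<in> \<O>" "snd v \<in> \<O>" "v \<noteq> (0, 0)" "\<And>A. A \<in> U \<Longrightarrow> \<exists>s\<in>F. A = transv v s"
proof -
  obtain v' where v': "v' \<noteq> (0, 0)" "\<And>A. A \<in> U \<Longrightarrow> \<exists>t. A = transv v' t"
    using unipotent_common_vector[OF unip] by blast
  have entries: "t * fst w * snd w \<in> \<O>" "t * (fst w)\<^sup>2 \<in> \<O>" "t * (snd w)\<^sup>2 \<in> \<O>"
    if A: "transv w t \<in> U" for w t
  proof -
    have *: "1 + t * fst w * snd w \<in> \<O>" "t * (fst w)\<^sup>2 \<in> \<O>" "- (t * (snd w)\<^sup>2) \<in> \<O>"
      using subsetD[OF sub A] by (simp_all add: transv_def)
    then show "t * (fst w)\<^sup>2 \<in> \<O>" by simp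
    show "t * fst w * snd w \<in> \<O>" using integers_closed(6)[OF *(1) integers_closed(2)] by simp
    show "t * (snd w)\<^sup>2 \<in> \<O>" using integers_closed(5)[OF *(3)] by simp
  qed
  obtain A1 where A1: "A1 \<in> U" "A1 \<noteq> 1\<^sub>m 2" using nontriv by blast
  obtain t1 where t1: "A1 = transv v' t1" using v'(2) A1(1) by blast
  have "t1 \<noteq> 0" using A1(2) t1 by auto
  \<comment> \<open>With this factor the coordinates of \<open>v\<close> become matrix entries of
    \<open>A1\<close> up to sign and the subtraction of 1, which are integral.\<close>
  define c where "c = (if fst v' \<noteq> 0 then t1 * fst v' else t1 * snd v')"
  have c: "c \<noteq> 0" using \<open>t1 \<noteq> 0\<close> v'(1) by (cases v') (auto simp: c_def)
  define v where "v = scale2 c v'"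
  have v: "fst v \<in> \<O>" "snd v \<in> \<O>"
    using entries[OF A1(1)[unfolded t1]] by (auto simp: v_def c_def scale2_def power2_eq_square mult_ac)
  have v0: "v \<noteq> (0, 0)" using c v'(1) by (cases v') (auto simp: v_def scale2_def)
  have "\<exists>s\<in>F. A = transv v s" if A: "A \<in> U" for A
  proof -
    obtain t where t: "A = transv v' t" using v'(2) A by blast
    define s where "s = t / c\<^sup>2"
    have s: "A = transv v s" using c by (simp add: s_def v_def transv_scale2 t)
    \<comment> \<open>A nonzero coordinate of \<open>v\<close>; the matrix entry
      \<open>s * x\<^sup>2\<close> is integral, so \<open>s\<close> is a quotient of elements of
      \<open>F\<close>.\<close>
    obtain x where x: "x \<in> \<O>" "x \<noteq> 0" "s * x\<^sup>2 \<in> \<O>"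
      using entries[OF A[unfolded s]] v v0 by (cases v) auto
    have "s = s * x\<^sup>2 * (inverse x * inverse x)" using x(2) by (simp add: field_simps power2_eq_square)
    moreover have "s * x\<^sup>2 * (inverse x * inverse x) \<in> F" using x by (intro field_closed integers_field)
    ultimately show ?thesis using s by (metis)
  qed
  with v v0 that show ?thesis by blast
qed

theorem theorem1p10:
  fixes F :: "complex set"
    and \<Gamma> U :: "complex mat set"
    and \<phi> :: "complex mat \<Rightarrow> real \<Rightarrow> real"
  assumes "number_field F"
    and "F \<noteq> \<rat>"
    and "\<not> imaginary_quadratic F"
    and "finite_index_subgroup \<Gamma> (SL 2 (ring_of_integers F))"
    and "\<not> (\<exists>K H. subfield K complex_field \<and> K \<subset> F \<and>
                 finite_index_subgroup H (integer_units F) \<and> H \<subseteq> K)"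
    and "subgroup U ((SL 2 (ring_of_integers F))\<lparr>carrier := \<Gamma>\<rparr>)"
    and "unipotent_subgroup 2 U"
    and "orientation_preserving_action ((SL 2 (ring_of_integers F))\<lparr>carrier := \<Gamma>\<rparr>) \<phi>"
  shows "\<forall>x. bounded (orbit ((SL 2 (ring_of_integers F))\<lparr>carrier := U\<rparr>) \<phi> x)"
proof
  fix x
  interpret arithmetic_subgroup F \<Gamma>
    by unfold_locales (rule assms)+
  have inf: "infinite unit_set" by (rule infinite_unit_set[OF assms(2,5)])
  have action: "group_action ((SL 2 (ring_of_integers F))\<lparr>carrier := \<Gamma>\<rparr>) UNIV \<phi>"
    using assms(8) by (simp add: orientation_preserving_action_def)
  have U: "U \<subseteq> \<Gamma>" using subgroup.subset[OF assms(6)] by simp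
  have mono: "strict_mono (\<phi> A)" if "A \<in> \<Gamma>" for A
    using assms(8) that by (simp add: orientation_preserving_action_def orientation_preserving_homeo_def)
  have mult: "\<phi> (A * B) y = \<phi> A (\<phi> B y)" if "A \<in> \<Gamma>" "B \<in> \<Gamma>" for A B y
    using group_action.composition_rule[OF action, of y A B] that by simp
  have one: "\<phi> (1\<^sub>m 2) y = y" for y
    using fun_cong[OF group_action.id_eq_one[OF action], of y] by simp
  have orbit: "orbit ((SL 2 (ring_of_integers F))\<lparr>carrier := U\<rparr>) \<phi> x = (\<lambda>A. \<phi> A x) ` U"
    by (auto simp: orbit_def)
  show "bounded (orbit ((SL 2 (ring_of_integers F))\<lparr>carrier := U\<rparr>) \<phi> x)"
  \<comment> \<open>A trivial \<open>U\<close> provides no transvection from which to read off an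
    integral vector.\<close>
  proof (cases "U \<subseteq> {1\<^sub>m 2}")
    case True
    then have "(\<lambda>A. \<phi> A x) ` U \<subseteq> {x}" using one by auto
    then show ?thesis unfolding orbit by (rule bounded_subset[rotated]) simp
  next
    case False
    have "U \<subseteq> carrier (SL 2 (ring_of_integers F))" using U Gamma_SL by blast
    from unipotent_common_integral_vector[OF assms(7) this False]
    obtain v where v: "fst v \<in> ring_of_integers F" "snd v \<in> ring_of_integers F" "v \<noteq> (0, 0)"
      and Uv: "\<And>A. A \<in> U \<Longrightarrow> \<exists>s\<in>F. A = transv v s" by blast
    obtain M where M: "\<forall>s\<in>F. transv v s \<in> \<Gamma> \<longrightarrow> \<phi> (transv v s) x \<le> M"
      using transv_orbit_bdd_above[OF inf mono mult one v] by blast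
    \<comment> \<open>The upper bound for the action reflected at 0, taken at the point
      \<open>- x\<close>, is the lower bound for \<phi> at \<open>x\<close>.\<close>
    have "\<exists>N. \<forall>s\<in>F. transv v s \<in> \<Gamma> \<longrightarrow> - \<phi> (transv v s) (- (- x)) \<le> N"
      by (rule transv_orbit_bdd_above[OF inf _ _ _ v, of "\<lambda>A y. - \<phi> A (- y)"])
        (use mono in \<open>simp_all add: strict_mono_def mult one\<close>)
    then obtain N where N: "\<forall>s\<in>F. transv v s \<in> \<Gamma> \<longrightarrow> - \<phi> (transv v s) x \<le> N" by auto
    have "norm (\<phi> A x) \<le> max M N" if A: "A \<in> U" for A
    proof -
      obtain s where "s \<in> F" "A = transv v s" using Uv[OF A] by blast
      then have "\<phi> A x \<le> M" "- \<phi> A x \<le> N" using M N A U by auto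
      then show ?thesis by (auto simp: abs_le_iff le_max_iff_disj)
    qed
    then show ?thesis unfolding orbit bounded_iff by blast
  qed
qed

end
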